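(* Let $1<p<\infty$ and let $w=uv^{1-p}$ be a weight on $\mathbb{R}$ in $A_p$ with $u,v\in A_1$. Let $c=A_1(u)$. Then $w\in RH_r$ for all $1<r<\frac{c}{c-1}$ (the upper bound being read as $\infty$ if $c=1$). Moreover, this range of $r$'s is best possible on $\mathbb{R}_+$: for every $1<p<\infty$ and every $c>1$ there are weights $u,v\in A_1$ on $\mathbb{R}_+$ with $A_1(u)=c$ and $w=uv^{1-p}\in A_p$ (all conditions taken over intervals $I\subset\mathbb{R}_+$) such that $w\notin RH_r$ on $\mathbb{R}_+$ for every $r\ge\frac{c}{c-1}$.
   Context: Let $X$ be $\mathbb{R}$ or $\mathbb{R}_+=(0,\infty)$. A weight on $X$ is a positive function integrable on every bounded interval $I\subset X$. Below $I$ denotes an arbitrary bounded interval contained in $X$, $|I|$ is its length, and $\inf_I$ means essential infimum over $I$. For $1<p<\infty$ with $p'=p/(p-1)$, $w\in A_p$ iff there is $C<\infty$ with $\frac{1}{|I|}\int_I w\left(\frac{1}{|I|}\int_I w^{1-p'}\right)^{p-1}\le C$ for all $I$. For $1<r<\infty$, $w\in RH_r$ iff there is $C<\infty$ with $\left(\frac{1}{|I|}\int_I w^r\right)^{1/r}\le C\,\frac{1}{|I|}\int_I w$ for all $I$. $w\in A_1$ iff there is $c<\infty$ with $\frac{1}{|I|}\int_I w\le c\inf_I w$ for all $I$; $A_1(w)$ denotes the infimum of all such constants $c$. *)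

theory Defs
  imports "HOL-Analysis.Analysis" "HOL-Probability.Essential_Supremum"
begin

definition bounded_intervals :: "real set \<Rightarrow> real set set" where
  "bounded_intervals X =
     {I. I \<subseteq> X \<and> is_interval I \<and> bounded I \<and> 0 < measure lebesgue I}"

definition average :: "real set \<Rightarrow> (real \<Rightarrow> real) \<Rightarrow> real" where
  "average I f = (LINT x:I|lebesgue. f x) / measure lebesgue I"

definition ess_inf :: "real set \<Rightarrow> (real \<Rightarrow> real) \<Rightarrow> ereal" where
  "ess_inf I f = - esssup (lebesgue_on I) (\<lambda>x. - ereal (f x))"

definition weight :: "real set \<Rightarrow> (real \<Rightarrow> real) \<Rightarrow> bool" where
  "weight X w \<longleftrightarrow>
     (\<forall>x\<in>X. 0 < w x) \<and> (\<forall>I\<in>bounded_intervals X. set_integrable lebesgue I w)"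

text \<open>The Bochner integral of a non-integrable function is \<open>0\<close>. Averages that may be
  infinite (those of \<open>w\<^sup>1\<^sup>-\<^sup>p\<^sup>'\<close> and \<open>w\<^sup>r\<close>) are therefore explicitly required to be finite.
  As \<open>w\<close> has positive average on every interval, this is part of the bound by a finite
  constant in both cases.\<close>

definition A_p :: "real \<Rightarrow> real set \<Rightarrow> (real \<Rightarrow> real) set" where
  "A_p p X = {w. weight X w \<and>
     (\<exists>C::real. \<forall>I\<in>bounded_intervals X.
        set_integrable lebesgue I (\<lambda>x. w x powr (1 - p / (p - 1))) \<and>
        average I w * average I (\<lambda>x. w x powr (1 - p / (p - 1))) powr (p - 1) \<le> C)}"

definition RH :: "real \<Rightarrow> real set \<Rightarrow> (real \<Rightarrow> real) set" where
  "RH r X = {w. weight X w \<and>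
     (\<exists>C::real. \<forall>I\<in>bounded_intervals X.
        set_integrable lebesgue I (\<lambda>x. w x powr r) \<and>
        average I (\<lambda>x. w x powr r) powr (1 / r) \<le> C * average I w)}"

definition A_1_bound :: "real set \<Rightarrow> (real \<Rightarrow> real) \<Rightarrow> real \<Rightarrow> bool" where
  "A_1_bound X w c \<longleftrightarrow>
     (\<forall>I\<in>bounded_intervals X. ereal (average I w) \<le> ereal c * ess_inf I w)"

definition A_1 :: "real set \<Rightarrow> (real \<Rightarrow> real) set" where
  "A_1 X = {w. weight X w \<and> (\<exists>c. A_1_bound X w c)}"

definition A_1_const :: "real set \<Rightarrow> (real \<Rightarrow> real) \<Rightarrow> real" where
  "A_1_const X w = Inf {c. A_1_bound X w c}"

end

theory Submission
  imports Defs
begin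

text \<open>
  Write \<open>w = u v\<^sup>1\<^sup>-\<^sup>p\<close> and fix an interval \<open>I\<close>.  Since \<open>v\<close> is in \<open>A\<^sub>1\<close>, it is bounded below almost
  everywhere on \<open>I\<close> by a multiple of its average, so \<open>v\<^sup>1\<^sup>-\<^sup>p\<close> is bounded above by a multiple of
  \<open>(average v)\<^sup>1\<^sup>-\<^sup>p\<close>; and by Jensen's inequality the average of \<open>v\<^sup>1\<^sup>-\<^sup>p\<close> is at least
  \<open>(average v)\<^sup>1\<^sup>-\<^sup>p\<close>.  The factor \<open>v\<^sup>1\<^sup>-\<^sup>p\<close> thus behaves like a constant in the reverse Hoelder
  inequality, which reduces the positive part to \<open>u\<close> alone (\<open>factored_weight_RH\<close>).

  That an \<open>A\<^sub>1\<close> weight \<open>u\<close> with constant \<open>c\<close> satisfies a reverse Hoelder inequality for every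
  \<open>r\<close> with \<open>c (r - 1) < r\<close>, which is \<open>r < c / (c - 1)\<close> if \<open>c > 1\<close>, is the heart of the matter.
  For a continuous \<open>u\<close> and a level \<open>t\<close> that is at least the average over \<open>I\<close>, the set
  \<open>{u > t}\<close> is a disjoint union of open intervals.  Apart from the case of a single component
  filling all of \<open>I\<close>, each of them has an endpoint at which \<open>u \<le> t\<close>, so the \<open>A\<^sub>1\<close> condition
  gives \<open>\<integral>\<^bsub>{u > t}\<^esub> u \<le> c t |{u > t}|\<close> with no loss in the constant (\<open>superlevel_integral_le\<close>).
  Multiplying by \<open>t\<^sup>r\<^sup>-\<^sup>2\<close> and integrating over \<open>t\<close> turns the two sides into essentially
  \<open>\<integral> u\<^sup>r / (r - 1)\<close> and \<open>c \<integral> u\<^sup>r / r\<close>.  Hence the integral of \<open>u\<^sup>r\<close> can be absorbed precisely if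
  \<open>c / r < 1 / (r - 1)\<close> (\<open>continuous_reverse_Holder\<close>).

  For a general \<open>u\<close> the endpoints of a component carry no information, because \<open>u\<close> is
  determined only almost everywhere.  The forward averages \<open>u\<^sub>h x = (\<integral> u over [x, x + h]) / h\<close> are
  continuous and satisfy the \<open>A\<^sub>1\<close> condition at every point with the same constant, because an
  integral of \<open>u\<^sub>h\<close> is an average over translates of an integral of \<open>u\<close> (\<open>steklov_A1_pointwise\<close>).
  They converge to \<open>u\<close> almost everywhere, and Fatou's lemma transfers the inequality
  (\<open>reverse_Holder_of_A1_pointwise\<close>).

  On the half-line the weight \<open>u x = x\<^sup>s\<^sup>-\<^sup>1\<close> with \<open>s = 1 / c\<close> has \<open>A\<^sub>1\<close> constant exactly \<open>c\<close>, and \<open>u\<^sup>r\<close>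
  is integrable at \<open>0\<close> only if \<open>r < c / (c - 1)\<close>; together with \<open>v = 1\<close> this shows sharpness.
\<close>

section \<open>Open sets of reals and the layer-cake formula\<close>

lemma bounded_interval_sandwich:
  fixes I :: "real set"
  assumes "is_interval I" "bounded I" "I \<noteq> {}"
  obtains a b where "{a<..<b} \<subseteq> I" "I \<subseteq> {a..b}"
proof
  have bdd: "bdd_above I" "bdd_below I"
    using assms(2) by (auto simp: bounded_imp_bdd_above bounded_imp_bdd_below)
  show "I \<subseteq> {Inf I..Sup I}"
    using bdd by (auto intro: cInf_lower cSup_upper)
  show "{Inf I<..<Sup I} \<subseteq> I"
  proof
    fix x assume "x \<in> {Inf I<..<Sup I}"
    then obtain y z where "y \<in> I" "y < x" "z \<in> I" "x < z"
      using cInf_lessD[OF assms(3), of x] less_cSupD[OF assms(3), of x] by auto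
    then show "x \<in> I"
      using mem_is_interval_1_I[OF assms(1), of y z x] by simp
  qed
qed

text \<open>The endpoints lie outside \<open>G\<close> because a component is a maximal connected subset.\<close>

lemma component_real_open_interval:
  fixes G :: "real set"
  assumes "open G" "bounded G" "C \<in> components G"
  obtains \<alpha> \<beta> where "\<alpha> < \<beta>" "C = {\<alpha><..<\<beta>}" "\<alpha> \<notin> G" "\<beta> \<notin> G"
proof -
  have C: "open C" "is_interval C" "C \<noteq> {}" "bounded C" "C \<subseteq> G"
    using open_components[OF assms(1,3)] in_components_connected[OF assms(3)]
      in_components_nonempty[OF assms(3)] in_components_subset[OF assms(3)]
      bounded_subset[OF assms(2)] by (auto simp: is_interval_connected_1)
  obtain \<alpha> \<beta> where sub: "{\<alpha><..<\<beta>} \<subseteq> C" "C \<subseteq> {\<alpha>..\<beta>}"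
    using bounded_interval_sandwich[OF C(2,4,3)] by blast
  have "C = interior C" using C(1) by (simp add: interior_open)
  also have "\<dots> \<subseteq> {\<alpha><..<\<beta>}"
    using interior_mono[OF sub(2)] by simp
  finally have \<alpha>\<beta>: "C = {\<alpha><..<\<beta>}" using sub(1) by blast
  have "\<alpha> < \<beta>" using \<alpha>\<beta> C(3) by auto
  have "\<alpha> \<notin> G"
  proof
    assume "\<alpha> \<in> G"
    then have "{\<alpha>..<\<beta>} \<subseteq> G"
      using C(5) unfolding \<alpha>\<beta> by (auto simp: less_le)
    moreover have "C \<inter> {\<alpha>..<\<beta>} \<noteq> {}"
      using dense[OF \<open>\<alpha> < \<beta>\<close>] unfolding \<alpha>\<beta> by force
    ultimately have "{\<alpha>..<\<beta>} \<subseteq> C"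
      by (intro components_maximal[OF assms(3)]) simp_all
    then show False using \<alpha>\<beta> \<open>\<alpha> < \<beta>\<close> by (metis atLeastLessThan_iff greaterThanLessThan_iff less_irrefl order_refl subsetD)
  qed
  moreover have "\<beta> \<notin> G"
  proof
    assume "\<beta> \<in> G"
    then have "{\<alpha><..\<beta>} \<subseteq> G"
      using C(5) unfolding \<alpha>\<beta> by (auto simp: less_le)
    moreover have "C \<inter> {\<alpha><..\<beta>} \<noteq> {}"
      using dense[OF \<open>\<alpha> < \<beta>\<close>] unfolding \<alpha>\<beta> by force
    ultimately have "{\<alpha><..\<beta>} \<subseteq> C"
      by (intro components_maximal[OF assms(3)]) simp_all
    then show False using \<alpha>\<beta> \<open>\<alpha> < \<beta>\<close> by (metis greaterThanAtMost_iff greaterThanLessThan_iff less_irrefl order_refl subsetD)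
  qed
  ultimately show thesis using that \<alpha>\<beta> \<open>\<alpha> < \<beta>\<close> by blast
qed

text \<open>An open set has only countably many components, each of them open, so both measures are
  sums over the components and the bound may be checked on each component separately.\<close>

lemma emeasure_open_le_of_components:
  fixes G :: "'a :: euclidean_space set"
  assumes "open G" and [measurable_cong]: "sets M = sets borel" "sets N = sets borel"
    and le: "\<And>C. C \<in> components G \<Longrightarrow> emeasure M C \<le> k * emeasure N C"
  shows "emeasure M G \<le> k * emeasure N G"
proof -
  have op: "open C" if "C \<in> components G" for C
    using that assms(1) open_components by blast
  have disj: "disjoint_family_on (\<lambda>C. C) (components G)"
    using pairwise_disjoint_components[of G] by (auto simp: disjoint_family_on_def pairwise_def)
  have cnt: "countable (components G)"
    using countable_disjoint_open_subsets[of "components G"] op pairwise_disjoint_components[of G]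
    by (simp add: disjnt_def pairwise_def)
  have em: "emeasure L G = (\<integral>\<^sup>+C. emeasure L C \<partial>count_space (components G))"
    if "sets L = sets borel" for L
    using emeasure_UN_countable[of "components G" "\<lambda>C. C" L] op cnt disj that
    by (simp add: Union_components)
  have "emeasure M G \<le> (\<integral>\<^sup>+C. k * emeasure N C \<partial>count_space (components G))"
    unfolding em[OF assms(2)] by (intro nn_integral_mono) (simp add: le)
  also have "\<dots> = k * emeasure N G"
    unfolding em[OF assms(3)] by (rule nn_integral_cmult) simp
  finally show ?thesis .
qed

text \<open>This is Tonelli's theorem: \<open>(y\<^sup>s - m\<^sup>s) / s\<close> is the integral of \<open>t\<^sup>s\<^sup>-\<^sup>1\<close> over \<open>m \<le> t < y\<close>.
  Starting at \<open>m > 0\<close> confines the right-hand side to superlevel sets of height at least \<open>m\<close>,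
  the only ones for which the estimate below is available.\<close>

lemma nn_integral_layer_cake_powr:
  fixes f :: "'a \<Rightarrow> real" and k :: "'a \<Rightarrow> ennreal"
  assumes "sigma_finite_measure M" and [measurable]: "f \<in> borel_measurable M" "k \<in> borel_measurable M"
    and s: "0 < s" and m: "0 < m"
  shows "(\<integral>\<^sup>+x. k x * ennreal ((f x powr s - m powr s) / s) * indicator {m..} (f x) \<partial>M) =
    (\<integral>\<^sup>+t. (\<integral>\<^sup>+x. k x * indicator {t<..} (f x) \<partial>M) * (ennreal (t powr (s - 1)) * indicator {m..} t) \<partial>lborel)"
    (is "?L = ?R")
proof -
  interpret M: sigma_finite_measure M by fact
  interpret pair_sigma_finite lborel M ..
  have inner: "(\<integral>\<^sup>+t. ennreal (t powr (s - 1)) * indicator {m..<y} t \<partial>lborel)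
      = ennreal ((y powr s - m powr s) / s) * indicator {m..} y" for y
  proof (cases "m \<le> y")
    case True
    have "(\<integral>\<^sup>+t. ennreal (t powr (s - 1)) * indicator {m..y} t \<partial>lborel)
      = ennreal (y powr s / s - m powr s / s)"
    proof (rule nn_integral_FTC_Icc[OF _ _ _ True])
      fix x assume "x \<in> {m..y}"
      then show "((\<lambda>t. t powr s / s) has_real_derivative x powr (s - 1)) (at x)"
        using m s by (auto intro!: derivative_eq_intros)
    qed simp_all
    moreover have "(\<integral>\<^sup>+t. ennreal (t powr (s - 1)) * indicator {m..<y} t \<partial>lborel) =
      (\<integral>\<^sup>+t. ennreal (t powr (s - 1)) * indicator {m..y} t \<partial>lborel)"
      by (rule nn_integral_cong_AE, rule eventually_mono[OF AE_lborel_singleton[of y]])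
         (auto split: split_indicator)
    ultimately show ?thesis using True by (simp add: diff_divide_distrib)
  qed auto
  define h where "h t x = (if m \<le> t \<and> t < f x then k x * ennreal (t powr (s - 1)) else 0)" for t x
  have h[measurable]: "(\<lambda>(t, x). h t x) \<in> borel_measurable (lborel \<Otimes>\<^sub>M M)"
    unfolding h_def by measurable
  have "?R = (\<integral>\<^sup>+t. \<integral>\<^sup>+x. h t x \<partial>M \<partial>lborel)"
  proof (rule nn_integral_cong)
    fix t :: real
    have "(\<integral>\<^sup>+x. k x * indicator {t<..} (f x) \<partial>M) * (ennreal (t powr (s - 1)) * indicator {m..} t)
      = (\<integral>\<^sup>+x. (k x * indicator {t<..} (f x)) * (ennreal (t powr (s - 1)) * indicator {m..} t) \<partial>M)"
      by (rule nn_integral_multc[symmetric]) measurable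
    also have "\<dots> = (\<integral>\<^sup>+x. h t x \<partial>M)"
      by (rule nn_integral_cong) (auto simp: h_def mult_ac split: split_indicator)
    finally show "(\<integral>\<^sup>+x. k x * indicator {t<..} (f x) \<partial>M) * (ennreal (t powr (s - 1)) * indicator {m..} t)
      = (\<integral>\<^sup>+x. h t x \<partial>M)" .
  qed
  also have "\<dots> = (\<integral>\<^sup>+x. \<integral>\<^sup>+t. h t x \<partial>lborel \<partial>M)"
    by (rule Fubini'[symmetric]) (rule h)
  also have "\<dots> = ?L"
  proof (rule nn_integral_cong)
    fix x
    have "(\<integral>\<^sup>+t. h t x \<partial>lborel) = (\<integral>\<^sup>+t. k x * (ennreal (t powr (s - 1)) * indicator {m..<f x} t) \<partial>lborel)"
      by (rule nn_integral_cong) (auto simp: h_def mult_ac split: split_indicator)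
    also have "\<dots> = k x * (\<integral>\<^sup>+t. ennreal (t powr (s - 1)) * indicator {m..<f x} t \<partial>lborel)"
      by (rule nn_integral_cmult) measurable
    also have "\<dots> = k x * ennreal ((f x powr s - m powr s) / s) * indicator {m..} (f x)"
      by (simp only: inner mult.assoc)
    finally show "(\<integral>\<^sup>+t. h t x \<partial>lborel)
      = k x * ennreal ((f x powr s - m powr s) / s) * indicator {m..} (f x)" .
  qed
  finally show ?thesis by simp
qed

section \<open>The sharp reverse Hoelder inequality for continuous functions\<close>

text \<open>The \<open>A\<^sub>1\<close> condition is applied on each component of the superlevel set at an endpoint that
  lies inside \<open>(a, b)\<close>; there \<open>g \<le> t\<close>.  If the component is all of \<open>(a, b)\<close> no such endpoint exists
  and the hypothesis on the average takes over.\<close>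

lemma superlevel_integral_le:
  fixes g :: "real \<Rightarrow> real"
  assumes cont: "continuous_on UNIV g" and nonneg: "\<And>x. 0 \<le> g x" and c: "1 \<le> c" and "0 \<le> t"
    and A1: "\<And>\<alpha> \<beta> x. a \<le> \<alpha> \<Longrightarrow> \<alpha> < \<beta> \<Longrightarrow> \<beta> \<le> b \<Longrightarrow> x \<in> {\<alpha>..\<beta>} \<Longrightarrow>
      integral {\<alpha>..\<beta>} g \<le> c * (\<beta> - \<alpha>) * g x"
    and avg: "integral {a..b} g \<le> t * (b - a)"
  shows "(\<integral>\<^sup>+x. ennreal (g x) * indicator {a<..<b} x * indicator {t<..} (g x) \<partial>lborel)
    \<le> ennreal (c * t) * (\<integral>\<^sup>+x. indicator {a<..<b} x * indicator {t<..} (g x) \<partial>lborel)"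
proof -
  have [measurable]: "g \<in> borel_measurable borel"
    using cont by (rule borel_measurable_continuous_onI)
  define G where "G = {x\<in>{a<..<b}. t < g x}"
  define M where "M = density lborel (\<lambda>x. ennreal (g x))"
  have "G = {a<..<b} \<inter> g -` {t<..}" by (auto simp: G_def)
  then have "open G"
    using continuous_open_preimage[OF cont open_UNIV, of "{t<..}"] by auto
  have "bounded G" by (rule bounded_subset[of "{a..b}"]) (auto simp: G_def)
  have [measurable]: "G \<in> sets borel" using \<open>open G\<close> by simp
  have "emeasure M G \<le> ennreal (c * t) * emeasure lborel G"
  proof (rule emeasure_open_le_of_components[OF \<open>open G\<close>])
    fix C assume "C \<in> components G"
    obtain \<alpha> \<beta> where C: "\<alpha> < \<beta>" "C = {\<alpha><..<\<beta>}" "\<alpha> \<notin> G" "\<beta> \<notin> G"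
      using component_real_open_interval[OF \<open>open G\<close> \<open>bounded G\<close> \<open>C \<in> components G\<close>] .
    have "{\<alpha><..<\<beta>} \<subseteq> {a<..<b}"
    proof -
      have "C \<subseteq> G" by (rule in_components_subset) fact
      also have "G \<subseteq> {a<..<b}" unfolding G_def by blast
      finally show ?thesis unfolding C(2) .
    qed
    then have ab: "a \<le> \<alpha>" "\<beta> \<le> b"
      using C(1) unfolding greaterThanLessThan_subseteq_greaterThanLessThan by simp_all
    have int: "g integrable_on {\<alpha>..\<beta>}"
      by (intro integrable_continuous_interval continuous_on_subset[OF cont]) simp
    have "integral {\<alpha>..\<beta>} g \<le> c * t * (\<beta> - \<alpha>)"
    proof (cases "\<alpha> = a \<and> \<beta> = b")
      case True
      then have "integral {\<alpha>..\<beta>} g \<le> 1 * (t * (\<beta> - \<alpha>))" using avg by simp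
      also have "\<dots> \<le> c * (t * (\<beta> - \<alpha>))"
        using c \<open>0 \<le> t\<close> C(1) by (intro mult_right_mono) auto
      finally show ?thesis by (simp add: mult_ac)
    next
      case False
      have "\<exists>x\<in>{\<alpha>..\<beta>}. g x \<le> t"
      proof (cases "\<alpha> = a")
        case True
        with False C(1) ab have "\<beta> \<in> {a<..<b}" by simp
        with C(4) have "g \<beta> \<le> t" by (simp add: G_def)
        with C(1) show ?thesis by force
      next
        case False
        with C(1) ab have "\<alpha> \<in> {a<..<b}" by simp
        with C(3) have "g \<alpha> \<le> t" by (simp add: G_def)
        with C(1) show ?thesis by force
      qed
      then obtain x where x: "x \<in> {\<alpha>..\<beta>}" "g x \<le> t" by blast
      have "integral {\<alpha>..\<beta>} g \<le> c * (\<beta> - \<alpha>) * g x"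
        using A1[of \<alpha> \<beta> x] C(1) ab x(1) by blast
      also have "\<dots> \<le> c * (\<beta> - \<alpha>) * t"
        using x(2) c C(1) by (intro mult_left_mono) auto
      finally show ?thesis by (simp add: mult_ac)
    qed
    moreover have "emeasure M C = ennreal (integral {\<alpha>..\<beta>} g)"
      unfolding M_def C(2) using int
      by (subst emeasure_density)
         (auto intro!: nn_integral_has_integral_lebesgue' nonneg simp flip: has_integral_Icc_iff_Ioo)
    moreover have "emeasure lborel C = ennreal (\<beta> - \<alpha>)"
      using C(1,2) by simp
    ultimately show "emeasure M C \<le> ennreal (c * t) * emeasure lborel C"
      using c \<open>0 \<le> t\<close> by (simp add: ennreal_mult'[symmetric] ennreal_leI)
  qed (simp_all add: M_def)
  also have "emeasure M G = (\<integral>\<^sup>+x. ennreal (g x) * indicator {a<..<b} x * indicator {t<..} (g x) \<partial>lborel)"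
    unfolding M_def by (subst emeasure_density) (auto intro!: nn_integral_cong simp: G_def split: split_indicator)
  also have "emeasure lborel G = (\<integral>\<^sup>+x. indicator G x \<partial>lborel)"
    by simp
  also have "\<dots> = (\<integral>\<^sup>+x. indicator {a<..<b} x * indicator {t<..} (g x) \<partial>lborel)"
    by (rule nn_integral_cong) (auto simp: G_def split: split_indicator)
  finally show ?thesis .
qed

text \<open>The superlevel estimate, multiplied by \<open>t\<^sup>r\<^sup>-\<^sup>2\<close> and integrated over \<open>t \<ge> m\<close>, says
  \<open>\<integral> g p \<le> c \<integral> q\<close> for the truncated powers \<open>p\<close> and \<open>q\<close> of the proof.  On \<open>{g > m}\<close> the difference
  \<open>g p - c q\<close> contains \<open>g\<^sup>r\<close> with the coefficient \<open>1 / (r - 1) - c / r\<close>, which is positive precisely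
  because \<open>c (r - 1) < r\<close>.\<close>

lemma continuous_reverse_Holder:
  fixes g :: "real \<Rightarrow> real"
  assumes cont: "continuous_on UNIV g" and nonneg: "\<And>x. 0 \<le> g x" and ab: "a < b"
    and c: "1 \<le> c" and r: "1 < r" and cr: "c * (r - 1) < r"
    and A1: "\<And>\<alpha> \<beta> x. a \<le> \<alpha> \<Longrightarrow> \<alpha> < \<beta> \<Longrightarrow> \<beta> \<le> b \<Longrightarrow> x \<in> {\<alpha>..\<beta>} \<Longrightarrow>
      integral {\<alpha>..\<beta>} g \<le> c * (\<beta> - \<alpha>) * g x"
    and m: "0 < m" "integral {a..b} g \<le> m * (b - a)"
  shows "integral {a..b} (\<lambda>x. g x powr r) \<le> r / (r - c * (r - 1)) * (m powr r * (b - a))"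
proof -
  have [measurable]: "g \<in> borel_measurable borel"
    using cont by (rule borel_measurable_continuous_onI)
  define p where "p x = (max (g x) m powr (r - 1) - m powr (r - 1)) / (r - 1)" for x
  define q where "q x = (max (g x) m powr r - m powr r) / r" for x
  have pq0: "0 \<le> p x" "0 \<le> q x" for x
    using r m(1) by (auto simp: p_def q_def intro!: divide_nonneg_nonneg powr_mono2)
  have cont': "continuous_on {a..b} g" using cont by (rule continuous_on_subset) simp
  have contp: "continuous_on {a..b} p" and contq: "continuous_on {a..b} q"
    unfolding p_def q_def using m(1) r by (auto intro!: continuous_intros cont')
  have int_gp: "(\<lambda>x. g x * p x) integrable_on {a..b}" and int_q: "q integrable_on {a..b}"
    and int_g: "g integrable_on {a..b}"
    by (auto intro!: integrable_continuous_interval continuous_intros contp contq cont')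
  have int_gr: "(\<lambda>x. g x powr r) integrable_on {a..b}"
    using r nonneg
    by (intro integrable_continuous_interval continuous_on_powr' cont' continuous_on_const) auto
  have to_nn: "(\<integral>\<^sup>+x. ennreal (f x) * indicator {a<..<b} x \<partial>lborel) = ennreal (integral {a..b} f)"
    if "f integrable_on {a..b}" "\<And>x. 0 \<le> f x" for f
    using that by (auto intro!: nn_integral_has_integral_lebesgue' simp flip: has_integral_Icc_iff_Ioo)

  define L where "L t = (\<integral>\<^sup>+x. ennreal (g x) * indicator {a<..<b} x * indicator {t<..} (g x) \<partial>lborel)" for t
  define S :: "real \<Rightarrow> ennreal"
    where "S t = (\<integral>\<^sup>+x. indicator {a<..<b} x * indicator {t<..} (g x) \<partial>lborel)" for t
  have [measurable]: "S \<in> borel_measurable borel"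
  proof -
    have "S = (\<lambda>t. \<integral>\<^sup>+x. (if a < x \<and> x < b \<and> t < g x then 1 else 0) \<partial>lborel)"
      unfolding S_def by (intro ext nn_integral_cong) (auto split: split_indicator)
    then show ?thesis by simp
  qed
  have sf: "sigma_finite_measure (lborel :: real measure)" ..
  have "ennreal (g x * p x) * indicator {a<..<b} x = (ennreal (g x) * indicator {a<..<b} x) *
      ennreal ((g x powr (r - 1) - m powr (r - 1)) / (r - 1)) * indicator {m..} (g x)" for x
    using nonneg[of x] by (simp add: p_def max_def ennreal_mult'[symmetric] split: split_indicator)
  then have eq1: "(\<integral>\<^sup>+x. ennreal (g x * p x) * indicator {a<..<b} x \<partial>lborel) =
      (\<integral>\<^sup>+t. L t * (ennreal (t powr (r - 1 - 1)) * indicator {m..} t) \<partial>lborel)"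
    unfolding L_def using r m(1)
    by (subst nn_integral_layer_cake_powr[OF sf, symmetric]) simp_all
  have "ennreal (q x) * indicator {a<..<b} x = indicator {a<..<b} x *
      ennreal ((g x powr r - m powr r) / r) * indicator {m..} (g x)" for x
    by (simp add: q_def max_def split: split_indicator)
  then have eq2: "(\<integral>\<^sup>+x. ennreal (q x) * indicator {a<..<b} x \<partial>lborel) =
      (\<integral>\<^sup>+t. S t * (ennreal (t powr (r - 1)) * indicator {m..} t) \<partial>lborel)"
    unfolding S_def using r m(1)
    by (subst nn_integral_layer_cake_powr[OF sf, symmetric]) simp_all
  have "L t * (ennreal (t powr (r - 1 - 1)) * indicator {m..} t)
      \<le> ennreal c * (S t * (ennreal (t powr (r - 1)) * indicator {m..} t))" for t
  proof (cases "m \<le> t")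
    case True
    then have "integral {a..b} g \<le> t * (b - a)"
      using m(2) ab by (smt (verit) mult_right_mono)
    then have "L t \<le> ennreal (c * t) * S t"
      unfolding L_def S_def using True m(1)
      by (intro superlevel_integral_le[OF cont nonneg c _ A1]) auto
    then have "L t * ennreal (t powr (r - 1 - 1)) \<le> ennreal (c * t) * S t * ennreal (t powr (r - 1 - 1))"
      by (rule mult_right_mono) simp
    also have "\<dots> = ennreal (c * t * t powr (r - 1 - 1)) * S t"
      using c True m(1) by (simp add: ennreal_mult mult_ac)
    also have "c * t * t powr (r - 1 - 1) = c * t powr (r - 1)"
      using True m(1) powr_mult_base[of t "r - 1 - 1"] by simp
    also have "ennreal \<dots> * S t = ennreal c * (S t * ennreal (t powr (r - 1)))"
      using c by (simp add: ennreal_mult mult_ac)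
    finally show ?thesis using True by simp
  qed simp
  then have "(\<integral>\<^sup>+t. L t * (ennreal (t powr (r - 1 - 1)) * indicator {m..} t) \<partial>lborel) \<le>
      (\<integral>\<^sup>+t. ennreal c * (S t * (ennreal (t powr (r - 1)) * indicator {m..} t)) \<partial>lborel)"
    by (rule nn_integral_mono)
  also have "\<dots> = ennreal c * (\<integral>\<^sup>+t. S t * (ennreal (t powr (r - 1)) * indicator {m..} t) \<partial>lborel)"
    by (rule nn_integral_cmult) measurable
  finally have "ennreal (integral {a..b} (\<lambda>x. g x * p x)) \<le> ennreal c * ennreal (integral {a..b} q)"
    unfolding eq1[symmetric] eq2[symmetric]
    using to_nn[OF int_gp] to_nn[OF int_q] pq0 nonneg by simp
  moreover have q_nonneg: "0 \<le> integral {a..b} q" by (intro integral_nonneg int_q pq0)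
  ultimately have gp_le: "integral {a..b} (\<lambda>x. g x * p x) \<le> c * integral {a..b} q"
    using c by (simp add: ennreal_mult'[symmetric])

  define \<delta> where "\<delta> = 1 / (r - 1) - c / r"
  have \<delta>: "0 < \<delta>" "\<delta> \<le> 1 / (r - 1)"
  proof -
    have "\<delta> = (r - c * (r - 1)) / (r * (r - 1))"
      using r by (simp add: \<delta>_def field_simps)
    then show "0 < \<delta>" using cr r by simp
    show "\<delta> \<le> 1 / (r - 1)" using c r by (simp add: \<delta>_def)
  qed
  \<comment> \<open>The lower-order term also covers the points where \<open>g \<le> m\<close> and \<open>p\<close> and \<open>q\<close> vanish.\<close>
  have pw: "\<delta> * g x powr r \<le> g x * p x - c * q x + m powr (r - 1) / (r - 1) * g x" for x
  proof (cases "m < g x")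
    case True
    then have "g x * g x powr (r - 1) = g x powr r"
      using m(1) powr_mult_base[of "g x" "r - 1"] by simp
    then have "g x * p x = g x powr r / (r - 1) - m powr (r - 1) / (r - 1) * g x"
      using True by (simp add: p_def max_def diff_divide_distrib right_diff_distrib mult.commute)
    moreover have "c * q x = c / r * g x powr r - c * m powr r / r"
      using True by (simp add: q_def max_def diff_divide_distrib right_diff_distrib)
    ultimately have "g x * p x - c * q x + m powr (r - 1) / (r - 1) * g x = \<delta> * g x powr r + c * m powr r / r"
      by (simp add: \<delta>_def left_diff_distrib)
    then show ?thesis using c r by simp
  next
    case False
    have "g x powr r = g x powr (r - 1) * g x"
      using nonneg[of x] powr_mult_base[of "g x" "r - 1"] by (simp add: mult.commute)
    also have "\<dots> \<le> m powr (r - 1) * g x"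
      using False nonneg[of x] r by (intro mult_right_mono powr_mono2) auto
    finally have "\<delta> * g x powr r \<le> 1 / (r - 1) * (m powr (r - 1) * g x)"
      using \<delta> r by (intro mult_mono) auto
    then show ?thesis using False by (simp add: p_def q_def max_def)
  qed
  have "\<delta> * integral {a..b} (\<lambda>x. g x powr r) = integral {a..b} (\<lambda>x. \<delta> * g x powr r)"
    by simp
  also have "\<dots> \<le> integral {a..b} (\<lambda>x. g x * p x - c * q x + m powr (r - 1) / (r - 1) * g x)"
    by (intro integral_le pw integrable_add integrable_diff integrable_on_mult_right
        int_gp int_q int_g int_gr)
  also have "\<dots> = integral {a..b} (\<lambda>x. g x * p x) - c * integral {a..b} q
      + m powr (r - 1) / (r - 1) * integral {a..b} g"
    by (subst integral_add, intro integrable_add integrable_diff integrable_on_mult_right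
        int_gp int_q int_g, intro integrable_on_mult_right int_g, subst integral_diff)
       (auto intro!: integrable_on_mult_right int_gp int_q int_g)
  also have "\<dots> \<le> m powr (r - 1) / (r - 1) * (m * (b - a))"
    using gp_le mult_left_mono[OF m(2), of "m powr (r - 1) / (r - 1)"] r by simp
  also have "\<dots> = m powr r * (b - a) / (r - 1)"
    using m(1) powr_mult_base[of m "r - 1"] by (simp add: mult_ac)
  finally have "integral {a..b} (\<lambda>x. g x powr r) \<le> m powr r * (b - a) / (r - 1) / \<delta>"
    using \<delta>(1) by (simp only: pos_le_divide_eq mult.commute[of _ \<delta>])
  also have "\<dots> = r / (r - c * (r - 1)) * (m powr r * (b - a))"
  proof -
    have "(r - 1) * \<delta> = (r - c * (r - 1)) / r"
      using r by (simp add: \<delta>_def field_simps)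
    then show ?thesis by (simp add: divide_divide_eq_left mult_ac)
  qed
  finally show ?thesis .
qed

section \<open>Steklov averages and the passage to locally integrable functions\<close>

definition steklov :: "real \<Rightarrow> (real \<Rightarrow> real) \<Rightarrow> real \<Rightarrow> real" where
  "steklov h u x = integral {x..x + h} u / h"

lemma continuous_on_steklov:
  fixes u :: "real \<Rightarrow> real"
  assumes int: "\<And>a b. u integrable_on {a..b}" and h: "0 < h"
  shows "continuous_on UNIV (steklov h u)"
proof -
  have "isCont (steklov h u) x" for x
  proof -
    define F where "F t = integral {x - 1..t} u" for t
    have F: "continuous_on {x - 1..x + 1 + h} F"
      unfolding F_def by (rule indefinite_integral_continuous_1[OF int])
    have "continuous_on {x - 1..x + 1} (\<lambda>y. (F (y + h) - F y) / h)"
      using h by (intro continuous_intros continuous_on_compose2[OF F] continuous_on_subset[OF F]) auto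
    moreover have "steklov h u y = (F (y + h) - F y) / h" if "y \<in> {x - 1..x + 1}" for y
      using Henstock_Kurzweil_Integration.integral_combine[of "x - 1" y "y + h" u] that int h
      by (simp add: steklov_def F_def)
    ultimately have "continuous_on {x - 1..x + 1} (steklov h u)"
      by (subst continuous_on_cong[where g = "\<lambda>y. (F (y + h) - F y) / h"]) auto
    then show ?thesis by (rule continuous_on_interior) simp
  qed
  then show ?thesis by (simp add: continuous_at_imp_continuous_on)
qed

text \<open>With a primitive \<open>F\<close> of \<open>u\<close>, both sides are second differences of a primitive of \<open>F\<close>
  over the corners \<open>\<alpha>\<close>, \<open>\<beta>\<close>, \<open>\<alpha> + h\<close>, \<open>\<beta> + h\<close>; this symmetry exchanges the order of integration.\<close>

lemma integral_steklov:
  fixes u :: "real \<Rightarrow> real"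
  assumes int: "\<And>a b. u integrable_on {a..b}" and h: "0 < h" and ab: "\<alpha> \<le> \<beta>"
  shows "(\<lambda>s. integral {\<alpha> + s..\<beta> + s} u) integrable_on {0..h}" (is ?int)
    and "integral {\<alpha>..\<beta>} (steklov h u) = integral {0..h} (\<lambda>s. integral {\<alpha> + s..\<beta> + s} u) / h" (is ?eq)
proof -
  define F where "F t = integral {\<alpha>..t} u" for t
  have F: "continuous_on {\<alpha>..\<beta> + h} F"
    unfolding F_def by (rule indefinite_integral_continuous_1[OF int])
  have F_int: "F integrable_on {x..y}" if "\<alpha> \<le> x" "y \<le> \<beta> + h" for x y
    using that by (intro integrable_continuous_interval continuous_on_subset[OF F]) auto
  have diff: "integral {x..y} u = F y - F x" if "\<alpha> \<le> x" "x \<le> y" for x y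
    using Henstock_Kurzweil_Integration.integral_combine[of \<alpha> x y u] that int by (simp add: F_def)
  have shift: "integral {x..y} (\<lambda>t. F (t + d)) = integral {x + d..y + d} F"
    "(\<lambda>t. F (t + d)) integrable_on {x..y}" if "\<alpha> \<le> x + d" "y + d \<le> \<beta> + h" for x y d
    using integral_shift_real_ivl[of "x + d" d "y + d" F]
      integrable_shift_real_ivl[of F "x + d" "y + d" d] F_int[OF that] by simp_all
  have eq: "integral {\<alpha> + s..\<beta> + s} u = F (s + \<beta>) - F (s + \<alpha>)" if "s \<in> {0..h}" for s
    using diff[of "\<alpha> + s" "\<beta> + s"] that ab by (simp add: add.commute)
  have "(\<lambda>s. F (s + \<beta>) - F (s + \<alpha>)) integrable_on {0..h}"
    using ab h by (intro integrable_diff shift(2)) auto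
  then show ?int
    using eq by (subst integrable_cong[where g = "\<lambda>s. F (s + \<beta>) - F (s + \<alpha>)"]) auto
  have "integral {0..h} (\<lambda>s. integral {\<alpha> + s..\<beta> + s} u) = integral {0..h} (\<lambda>s. F (s + \<beta>) - F (s + \<alpha>))"
    using eq by (rule integral_cong)
  also have "\<dots> = integral {\<beta>..\<beta> + h} F - integral {\<alpha>..\<alpha> + h} F"
    using ab h shift[of 0 \<alpha> h] shift[of 0 \<beta> h] by (subst integral_diff) (auto simp: add.commute)
  also have "\<dots> = integral {\<alpha> + h..\<beta> + h} F - integral {\<alpha>..\<beta>} F"
    using Henstock_Kurzweil_Integration.integral_combine[of \<alpha> \<beta> "\<beta> + h" F]
      Henstock_Kurzweil_Integration.integral_combine[of \<alpha> "\<alpha> + h" "\<beta> + h" F]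
      F_int[of \<alpha> "\<beta> + h"] ab h by simp
  also have "\<dots> = integral {\<alpha>..\<beta>} (\<lambda>x. F (x + h) - F x)"
    using ab h shift[of \<alpha> h \<beta>] F_int[of \<alpha> \<beta>] by (subst integral_diff) auto
  also have "\<dots> = integral {\<alpha>..\<beta>} (\<lambda>x. h * steklov h u x)"
    using h diff by (intro integral_cong) (simp add: steklov_def)
  finally show ?eq using h by simp
qed

text \<open>The \<open>A\<^sub>1\<close> inequality on the translates \<open>[\<alpha> + s, \<beta> + s]\<close> at the points \<open>x + s\<close> is integrated
  over \<open>s\<close> in \<open>[0, h]\<close>.  The exceptional set is met only for a null set of \<open>s\<close>, so the averaged
  inequality holds at every \<open>x\<close>, with the same constant.\<close>

lemma steklov_A1_pointwise:
  fixes u :: "real \<Rightarrow> real"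
  assumes int: "\<And>a b. u integrable_on {a..b}" and h: "0 < h"
    and N: "negligible N"
    and A1: "\<And>\<alpha> \<beta> y. y \<notin> N \<Longrightarrow> \<alpha> < \<beta> \<Longrightarrow> y \<in> {\<alpha>..\<beta>} \<Longrightarrow> integral {\<alpha>..\<beta>} u \<le> c * (\<beta> - \<alpha>) * u y"
    and ab: "\<alpha> < \<beta>" "x \<in> {\<alpha>..\<beta>}"
  shows "integral {\<alpha>..\<beta>} (steklov h u) \<le> c * (\<beta> - \<alpha>) * steklov h u x"
proof -
  define N' where "N' = (+) (- x) ` N"
  have N': "negligible N'"
    unfolding N'_def using N by (rule negligible_translation)
  let ?f = "\<lambda>s. integral {\<alpha> + s..\<beta> + s} u" and ?g = "\<lambda>s. c * (\<beta> - \<alpha>) * u (s + x)"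
  have g: "?g integrable_on {0..h}"
    using integrable_shift_real_ivl[OF int, of x x "x + h"] by (intro integrable_on_mult_right) simp
  have "integral {0..h} ?f \<le> integral {0..h} (\<lambda>s. if s \<in> N' then ?f s else ?g s)"
  proof (rule integral_le)
    show "?f integrable_on {0..h}" using int h ab(1) by (intro integral_steklov(1)) auto
    show "(\<lambda>s. if s \<in> N' then ?f s else ?g s) integrable_on {0..h}"
      by (rule integrable_spike[OF g N']) simp
    show "?f s \<le> (if s \<in> N' then ?f s else ?g s)" if "s \<in> {0..h}" for s
    proof (cases "s \<in> N'")
      case False
      then have "s + x \<notin> N" by (auto simp: N'_def image_iff algebra_simps)
      then show ?thesis using A1[of "s + x" "\<alpha> + s" "\<beta> + s"] ab False by simp
    qed simp
  qed
  also have "\<dots> = integral {0..h} ?g"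
    by (rule integral_spike[OF N']) simp
  also have "\<dots> = c * (\<beta> - \<alpha>) * integral {x..x + h} u"
    using integral_shift_real_ivl[of x x "x + h" u] by simp
  finally show ?thesis
    using h integral_steklov(2)[OF int h, of \<alpha> \<beta>] ab(1)
    by (simp add: steklov_def divide_right_mono)
qed

text \<open>The constant in the inequality for the continuous Steklov averages does not depend on the
  step, so Fatou's lemma applies as the step tends to \<open>0\<close>.\<close>

lemma reverse_Holder_of_A1_pointwise:
  fixes u :: "real \<Rightarrow> real"
  assumes int: "\<And>a b. u integrable_on {a..b}" and pos: "\<And>x. 0 < u x"
    and c: "1 \<le> c" and r: "1 < r" and cr: "c * (r - 1) < r" and N: "negligible N"
    and A1: "\<And>\<alpha> \<beta> y. y \<notin> N \<Longrightarrow> \<alpha> < \<beta> \<Longrightarrow> y \<in> {\<alpha>..\<beta>} \<Longrightarrow> integral {\<alpha>..\<beta>} u \<le> c * (\<beta> - \<alpha>) * u y"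
    and ab: "a < b" and avg_pos: "0 < integral {a..b} u"
  shows "(\<integral>\<^sup>+x. ennreal (u x powr r) * indicator {a..b} x \<partial>lebesgue)
    \<le> ennreal (r / (r - c * (r - 1)) * ((integral {a..b} u / (b - a)) powr r * (b - a)))"
proof -
  let ?K = "r / (r - c * (r - 1))"
  define h where "h n = inverse (real (Suc n))" for n
  have h: "0 < h n" "h n \<le> 1" for n by (auto simp: h_def field_simps)
  have h0: "h \<longlonglongrightarrow> 0" unfolding h_def by (rule LIMSEQ_inverse_real_of_nat)
  define g where "g n = steklov (h n) u" for n
  have g_cont: "continuous_on UNIV (g n)" for n
    unfolding g_def by (rule continuous_on_steklov[OF int h(1)])
  then have [measurable]: "g n \<in> borel_measurable borel" for n
    by (rule borel_measurable_continuous_onI)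
  have g_nonneg: "0 \<le> g n x" for n x
    unfolding g_def steklov_def
    using h(1)[of n] pos by (intro divide_nonneg_nonneg integral_nonneg int) (auto intro: less_imp_le)
  have F_mono: "integral {\<alpha>..\<beta>} u \<le> integral {\<alpha>'..\<beta>'} u" if "\<alpha>' \<le> \<alpha>" "\<beta> \<le> \<beta>'" for \<alpha> \<beta> \<alpha>' \<beta>'
    using that pos by (intro integral_subset_le int) (auto intro: less_imp_le)
  \<comment> \<open>A Steklov average looks ahead by \<open>h n\<close>, so its mean over \<open>[a, b]\<close> is controlled by the
    integral of \<open>u\<close> over the enlarged interval.\<close>
  define m where "m n = integral {a..b + h n} u / (b - a)" for n
  have m_pos: "0 < m n" for n
    using avg_pos F_mono[of a a b "b + h n"] h(1)[of n] ab by (auto simp: m_def intro!: divide_pos_pos)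
  have avg_g: "integral {a..b} (g n) \<le> m n * (b - a)" for n
  proof -
    have "integral {0..h n} (\<lambda>s. integral {a + s..b + s} u) \<le> integral {0..h n} (\<lambda>s. integral {a..b + h n} u)"
      using ab h(1)[of n] int by (intro integral_le integral_steklov(1) F_mono) auto
    then have "integral {a..b} (g n) \<le> integral {a..b + h n} u"
      using integral_steklov(2)[OF int h(1), of a b n] ab h(1)[of n]
      by (simp add: g_def pos_divide_le_eq mult.commute)
    then show ?thesis using ab by (simp add: m_def)
  qed
  have RH_g: "(\<integral>\<^sup>+x. ennreal (g n x powr r) * indicator {a..b} x \<partial>lborel)
      \<le> ennreal (?K * (m n powr r * (b - a)))" for n
  proof -
    have "(\<lambda>x. g n x powr r) integrable_on {a..b}"
      using g_nonneg r continuous_on_subset[OF g_cont[of n]]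
      by (intro integrable_continuous_interval continuous_on_powr' continuous_on_const) auto
    then have "(\<integral>\<^sup>+x. ennreal (g n x powr r) * indicator {a..b} x \<partial>lborel)
        = ennreal (integral {a..b} (\<lambda>x. g n x powr r))"
      by (intro nn_integral_has_integral_lebesgue' integrable_integral) auto
    also have "\<dots> \<le> ennreal (?K * (m n powr r * (b - a)))"
      unfolding g_def
      by (intro ennreal_leI continuous_reverse_Holder c r cr ab m_pos avg_g[unfolded g_def] g_nonneg[unfolded g_def]
          g_cont[unfolded g_def] steklov_A1_pointwise[OF int h(1) N A1])
    finally show ?thesis .
  qed
  \<comment> \<open>Lebesgue's differentiation theorem.\<close>
  obtain N' where N': "negligible N'"
    "\<And>x e. x \<notin> N' \<Longrightarrow> 0 < e \<Longrightarrow> \<exists>d>0. \<forall>h. 0 < h \<and> h < d \<longrightarrow>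
        norm (integral (cbox x (x + h *\<^sub>R One)) u /\<^sub>R h ^ DIM(real) - u x) < e"
    using integrable_ccontinuous_explicit[of u] int by (metis box_real(2))
  have lim: "(\<lambda>n. g n x) \<longlonglongrightarrow> u x" if "x \<notin> N'" for x
  proof (rule LIMSEQ_I)
    fix e :: real assume "0 < e"
    then obtain d where d: "0 < d" "\<And>h. 0 < h \<Longrightarrow> h < d \<Longrightarrow> norm (integral {x..x + h} u /\<^sub>R h - u x) < e"
      using N'(2)[OF \<open>x \<notin> N'\<close>, of e] by force
    obtain n0 where "\<And>n. n \<ge> n0 \<Longrightarrow> h n < d"
      using order_tendstoD(2)[OF h0 d(1)] by (auto simp: eventually_sequentially)
    then show "\<exists>n0. \<forall>n\<ge>n0. norm (g n x - u x) < e"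
      using d(2) h(1) by (auto simp: g_def steklov_def divide_inverse mult.commute)
  qed
  have ae: "AE x in lborel. x \<notin> N'"
    using N'(1) AE_not_in[of N' lebesgue] by (simp add: negligible_iff_null_sets AE_completion_iff)
  have "(\<integral>\<^sup>+x. ennreal (u x powr r) * indicator {a..b} x \<partial>lebesgue)
      = (\<integral>\<^sup>+x. ennreal (u x powr r) * indicator {a..b} x \<partial>lborel)"
    by (rule nn_integral_completion)
  also have "\<dots> = (\<integral>\<^sup>+x. liminf (\<lambda>n. ennreal (g n x powr r) * indicator {a..b} x) \<partial>lborel)"
  proof (rule nn_integral_cong_AE, rule eventually_mono[OF ae])
    fix x assume "x \<notin> N'"
    then have "(\<lambda>n. ennreal (g n x powr r) * indicator {a..b} x) \<longlonglongrightarrow> ennreal (u x powr r) * indicator {a..b} x"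
      using lim[of x] pos[of x] by (auto intro!: tendsto_intros split: split_indicator)
    then show "ennreal (u x powr r) * indicator {a..b} x = liminf (\<lambda>n. ennreal (g n x powr r) * indicator {a..b} x)"
      by (simp add: lim_imp_Liminf)
  qed
  also have "\<dots> \<le> liminf (\<lambda>n. \<integral>\<^sup>+x. ennreal (g n x powr r) * indicator {a..b} x \<partial>lborel)"
    by (rule nn_integral_liminf) measurable
  also have "\<dots> \<le> liminf (\<lambda>n. ennreal (?K * (m n powr r * (b - a))))"
    by (intro Liminf_mono always_eventually allI RH_g)
  also have "\<dots> = ennreal (?K * ((integral {a..b} u / (b - a)) powr r * (b - a)))"
  proof (rule lim_imp_Liminf[OF sequentially_bot])
    have F: "continuous_on {a..b + 1} (\<lambda>t. integral {a..t} u)"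
      by (rule indefinite_integral_continuous_1[OF int])
    have "(\<lambda>n. b + h n) \<longlonglongrightarrow> b + 0" by (intro tendsto_intros h0)
    then have "(\<lambda>n. integral {a..b + h n} u) \<longlonglongrightarrow> integral {a..b} u"
    proof (intro continuous_on_tendsto_compose[OF F] always_eventually allI)
      show "b + h n \<in> {a..b + 1}" for n
        using ab h[of n] by simp
    qed (use ab in simp_all)
    then have "m \<longlonglongrightarrow> integral {a..b} u / (b - a)"
      unfolding m_def using ab by (intro tendsto_intros) auto
    then show "(\<lambda>n. ennreal (?K * (m n powr r * (b - a)))) \<longlonglongrightarrow>
        ennreal (?K * ((integral {a..b} u / (b - a)) powr r * (b - a)))"
      using ab avg_pos by (intro tendsto_intros) auto
  qed
  finally show ?thesis .
qed

section \<open>Averages over intervals and the pointwise form of the A1 condition\<close>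

lemma bounded_intervals_endpoints:
  assumes "I \<in> bounded_intervals X"
  obtains a b where "a < b" "{a<..<b} \<subseteq> I" "I \<subseteq> {a..b}"
proof -
  have I: "is_interval I" "bounded I" "0 < measure lebesgue I"
    using assms by (auto simp: bounded_intervals_def)
  then have "I \<noteq> {}" by auto
  then obtain a b where ab: "{a<..<b} \<subseteq> I" "I \<subseteq> {a..b}"
    using bounded_interval_sandwich[OF I(1,2)] by blast
  have "a < b"
  proof (rule ccontr)
    assume "\<not> a < b"
    then have "I \<subseteq> {a}" using ab(2) by auto
    then have "I = {} \<or> I = {a}" by blast
    then show False using I(3) by auto
  qed
  with ab that show thesis by blast
qed

text \<open>Whether the endpoints belong to an interval is irrelevant for every notion in the
  definitions of the weight classes, so all computations can be done on \<open>[a, b]\<close>.\<close>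

lemma interval_up_to_endpoints:
  fixes I :: "real set"
  assumes ab: "a < b" "{a<..<b} \<subseteq> I" "I \<subseteq> {a..b}"
  shows "I \<in> lmeasurable" and "measure lebesgue I = b - a"
    and "set_integrable lebesgue I f \<longleftrightarrow> f absolutely_integrable_on {a..b}"
    and "f absolutely_integrable_on {a..b} \<Longrightarrow> average I f = integral {a..b} f / (b - a)"
    and "(AE x in lebesgue. x \<in> I \<longrightarrow> P x) \<longleftrightarrow> (AE x in lebesgue. x \<in> {a..b} \<longrightarrow> P x)"
proof -
  have sub: "I - {a..b} = {}" "{a..b} - I \<subseteq> {a, b}"
    using ab(2,3) by (auto simp: subset_eq)
  have neg: "negligible (I - {a..b})" "negligible ({a..b} - I)"
    unfolding sub(1) using negligible_subset[OF negligible_finite sub(2)] by simp_all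
  have "I = {a<..<b} \<union> (I \<inter> {a, b})" using ab by auto
  moreover have "I \<inter> {a, b} \<in> sets borel" by (rule borel_closed, rule finite_imp_closed) simp
  ultimately have "I \<in> sets borel" by (metis sets.Un borel_open open_greaterThanLessThan)
  then have sets: "I \<in> sets lebesgue" by simp
  show lmeas: "I \<in> lmeasurable"
    by (rule bounded_set_imp_lmeasurable[OF bounded_subset[OF _ ab(3)] sets]) simp
  have "AE x in lebesgue. x \<notin> {a..b} - I"
    using neg(2) unfolding negligible_iff_null_sets by (rule AE_not_in)
  then have AE_iff: "AE x in lebesgue. x \<in> I \<longleftrightarrow> x \<in> {a..b}"
    by (rule eventually_mono) (use ab(3) in blast)
  then have "emeasure lebesgue I = emeasure lebesgue {a..b}"
    using sets by (intro emeasure_eq_AE) simp_all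
  then show "measure lebesgue I = b - a"
    using ab(1) by (simp add: measure_def)
  have neg': "negligible {x \<in> I - {a..b}. f x \<noteq> 0}" "negligible {x \<in> {a..b} - I. f x \<noteq> 0}"
    for f :: "real \<Rightarrow> real"
    by (rule negligible_subset[OF neg(1)], blast, rule negligible_subset[OF neg(2)], blast)
  show iff: "set_integrable lebesgue I f \<longleftrightarrow> f absolutely_integrable_on {a..b}"
    using neg' by (rule absolutely_integrable_spike_set_eq)
  show "average I f = integral {a..b} f / (b - a)" if "f absolutely_integrable_on {a..b}"
    using that iff \<open>measure lebesgue I = b - a\<close> integral_spike_set[OF neg']
    by (simp add: average_def set_lebesgue_integral_eq_integral(2))
  show "(AE x in lebesgue. x \<in> I \<longrightarrow> P x) \<longleftrightarrow> (AE x in lebesgue. x \<in> {a..b} \<longrightarrow> P x)"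
  proof
    assume "AE x in lebesgue. x \<in> I \<longrightarrow> P x"
    with AE_iff show "AE x in lebesgue. x \<in> {a..b} \<longrightarrow> P x" by eventually_elim blast
  next
    assume "AE x in lebesgue. x \<in> {a..b} \<longrightarrow> P x"
    with AE_iff show "AE x in lebesgue. x \<in> I \<longrightarrow> P x" by eventually_elim blast
  qed
qed

lemma bounded_intervalsD:
  assumes "I \<in> bounded_intervals X"
  shows "I \<subseteq> X" "I \<in> lmeasurable" "I \<in> sets lebesgue" "0 < measure lebesgue I"
proof -
  obtain a b where "a < b" "{a<..<b} \<subseteq> I" "I \<subseteq> {a..b}"
    using bounded_intervals_endpoints[OF assms] .
  then show "I \<in> lmeasurable" by (rule interval_up_to_endpoints(1))
  then show "I \<in> sets lebesgue" by simp
  show "I \<subseteq> X" "0 < measure lebesgue I" using assms by (auto simp: bounded_intervals_def)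
qed

lemma average_mono_AE:
  assumes "set_integrable lebesgue I f" "set_integrable lebesgue I g"
    and "AE x in lebesgue. x \<in> I \<longrightarrow> f x \<le> g x"
  shows "average I f \<le> average I g"
  unfolding average_def
  by (intro divide_right_mono set_integral_mono_AE assms) simp

lemma average_cmult: "average I (\<lambda>x. k * f x) = k * average I f"
  by (simp add: average_def)

lemma average_const: "I \<in> bounded_intervals X \<Longrightarrow> average I (\<lambda>x. k) = k"
  using bounded_intervalsD(2,4)[of I X]
  by (simp add: average_def set_lebesgue_integral_def)

lemma set_integrable_const_interval: "I \<in> bounded_intervals X \<Longrightarrow> set_integrable lebesgue I (\<lambda>x. k :: real)"
  using bounded_intervalsD(2)[of I X]
  by (simp add: set_integrable_def lmeasurable_iff_integrable)

lemma average_pos: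
  assumes I: "I \<in> bounded_intervals X" and f: "set_integrable lebesgue I f" "\<And>x. x \<in> I \<Longrightarrow> 0 < f x"
  shows "0 < average I f"
proof -
  have nonneg: "AE x in lebesgue. 0 \<le> indicator I x *\<^sub>R f x"
    by (rule AE_I2) (auto simp: indicator_def intro: less_imp_le[OF f(2)])
  have "(LINT x:I|lebesgue. f x) \<noteq> 0"
  proof
    assume "(LINT x:I|lebesgue. f x) = 0"
    then have "AE x in lebesgue. indicator I x *\<^sub>R f x = 0"
      using f(1) integral_nonneg_eq_0_iff_AE[OF _ nonneg]
      by (simp add: set_lebesgue_integral_def set_integrable_def)
    then have "AE x in lebesgue. x \<notin> I"
      by (rule eventually_mono) (use f(2) in \<open>force simp: indicator_def\<close>)
    then have "I \<in> null_sets lebesgue"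
      using bounded_intervalsD(3)[OF I] by (simp add: AE_iff_null_sets)
    then show False using bounded_intervalsD(4)[OF I] by (simp add: measure_def null_setsD1)
  qed
  moreover have "0 \<le> (LINT x:I|lebesgue. f x)"
    unfolding set_lebesgue_integral_def using nonneg by (rule integral_nonneg_AE)
  ultimately show ?thesis
    using bounded_intervalsD(4)[OF I] by (simp add: average_def)
qed

lemma weightD:
  assumes "weight X w" "I \<in> bounded_intervals X"
  shows "set_integrable lebesgue I w" "0 < average I w" "\<And>x. x \<in> I \<Longrightarrow> 0 < w x"
proof -
  show *: "set_integrable lebesgue I w" "\<And>x. x \<in> I \<Longrightarrow> 0 < w x"
    using assms bounded_intervalsD(1)[OF assms(2)] by (auto simp: weight_def)
  show "0 < average I w" using average_pos[OF assms(2) *] .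
qed

text \<open>The essential infimum is the largest lower bound valid almost everywhere.  Positivity of \<open>c\<close>
  is forced by any single interval, on which the average is positive; without an interval every
  \<open>c\<close> would be a bound.\<close>

lemma A_1_bound_iff_AE:
  assumes w: "weight X w" and ne: "bounded_intervals X \<noteq> {}"
  shows "A_1_bound X w c \<longleftrightarrow> 0 < c \<and>
    (\<forall>I\<in>bounded_intervals X. AE x in lebesgue. x \<in> I \<longrightarrow> average I w \<le> c * w x)"
proof -
  have meas: "(\<lambda>x. - ereal (w x)) \<in> borel_measurable (lebesgue_on I)"
    if I: "I \<in> bounded_intervals X" for I
  proof -
    have "w \<in> borel_measurable (lebesgue_on I)"
      using weightD(1)[OF w I] bounded_intervalsD(3)[OF I]
      by (auto simp: set_integrable_def borel_measurable_restrict_space_iff dest!: borel_measurable_integrable)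
    then show ?thesis by measurable
  qed
  have AE_on: "(AE x in lebesgue_on I. P x) \<longleftrightarrow> (AE x in lebesgue. x \<in> I \<longrightarrow> P x)"
    if I: "I \<in> bounded_intervals X" for I P
    using bounded_intervalsD(3)[OF I] by (intro AE_restrict_space_iff) simp
  have ess_inf_ge: "y \<le> ess_inf I w"
    if I: "I \<in> bounded_intervals X" and y: "AE x in lebesgue. x \<in> I \<longrightarrow> y \<le> ereal (w x)" for I y
  proof -
    have "AE x in lebesgue_on I. - ereal (w x) \<le> - y"
      unfolding AE_on[OF I] using y by (simp add: ereal_minus_le_minus del: uminus_ereal.simps)
    then have "esssup (lebesgue_on I) (\<lambda>x. - ereal (w x)) \<le> - y"
      by (rule esssup_I[OF meas[OF I]])
    then have "- (- y) \<le> ess_inf I w"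
      unfolding ess_inf_def ereal_minus_le_minus .
    then show ?thesis by simp
  qed
  show ?thesis
  proof (intro iffI conjI ballI)
    assume A: "A_1_bound X w c"
    show "0 < c"
    proof -
      obtain I where I: "I \<in> bounded_intervals X" using ne by blast
      have "0 \<le> ess_inf I w"
        by (rule ess_inf_ge[OF I]) (auto intro!: AE_I2 less_imp_le[OF weightD(3)[OF w I]])
      moreover have "0 < ereal c * ess_inf I w"
      proof -
        have "ereal 0 < ereal (average I w)" using weightD(2)[OF w I] by simp
        also have "\<dots> \<le> ereal c * ess_inf I w" using A I by (simp add: A_1_bound_def)
        finally show ?thesis unfolding zero_ereal_def .
      qed
      ultimately show "0 < c"
        by (cases "ess_inf I w") (auto simp: zero_less_mult_iff split: if_splits)
    qed
    fix I assume I: "I \<in> bounded_intervals X"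
    have "AE x in lebesgue. x \<in> I \<longrightarrow> ess_inf I w \<le> ereal (w x)"
      using esssup_AE[of "\<lambda>x. - ereal (w x)" "lebesgue_on I"]
      unfolding AE_on[OF I] ess_inf_def by (simp add: ereal_uminus_le_reorder)
    then show "AE x in lebesgue. x \<in> I \<longrightarrow> average I w \<le> c * w x"
    proof (rule eventually_mono, intro impI)
      fix x assume "x \<in> I \<longrightarrow> ess_inf I w \<le> ereal (w x)" "x \<in> I"
      then have *: "ereal c * ess_inf I w \<le> ereal c * ereal (w x)"
        using \<open>0 < c\<close> by (intro ereal_mult_left_mono) auto
      have "ereal (average I w) \<le> ereal c * ess_inf I w"
        using A I by (simp add: A_1_bound_def)
      also note *
      finally show "average I w \<le> c * w x" by simp
    qed
  next
    assume A: "0 < c \<and> (\<forall>I\<in>bounded_intervals X. AE x in lebesgue. x \<in> I \<longrightarrow> average I w \<le> c * w x)"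
    show "A_1_bound X w c"
      unfolding A_1_bound_def
    proof
      fix I assume I: "I \<in> bounded_intervals X"
      have "ereal (average I w / c) \<le> ess_inf I w"
        using A I by (intro ess_inf_ge[OF I]) (auto simp: pos_divide_le_eq mult.commute)
      then have "ereal c * ereal (average I w / c) \<le> ereal c * ess_inf I w"
        using A by (intro ereal_mult_left_mono) auto
      then show "ereal (average I w) \<le> ereal c * ess_inf I w" using A by simp
    qed
  qed
qed

lemma A_1_bound_mono:
  assumes w: "weight X w" and ne: "bounded_intervals X \<noteq> {}" and A: "A_1_bound X w c" and le: "c \<le> c'"
  shows "A_1_bound X w c'"
  unfolding A_1_bound_iff_AE[OF w ne]
proof (intro conjI ballI)
  have c: "0 < c" using A unfolding A_1_bound_iff_AE[OF w ne] by blast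
  with le show "0 < c'" by simp
  fix I assume I: "I \<in> bounded_intervals X"
  then have "AE x in lebesgue. x \<in> I \<longrightarrow> average I w \<le> c * w x"
    using A unfolding A_1_bound_iff_AE[OF w ne] by blast
  then show "AE x in lebesgue. x \<in> I \<longrightarrow> average I w \<le> c' * w x"
  proof (rule eventually_mono, intro impI)
    fix x assume "x \<in> I \<longrightarrow> average I w \<le> c * w x" "x \<in> I"
    moreover from \<open>x \<in> I\<close> have "c * w x \<le> c' * w x"
      using weightD(3)[OF w I] le by (intro mult_right_mono) (simp_all add: less_imp_le)
    ultimately show "average I w \<le> c' * w x" by linarith
  qed
qed

section \<open>Reverse Hoelder inequalities for A1 weights and for factored weights\<close>

lemma Icc_in_bounded_intervals: "a < b \<Longrightarrow> {a..b} \<subseteq> X \<Longrightarrow> {a..b} \<in> bounded_intervals X" for a b :: real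
  by (simp add: bounded_intervals_def is_interval_cc)

lemma bounded_intervals_UNIV_nonempty: "bounded_intervals UNIV \<noteq> {}"
  using Icc_in_bounded_intervals[of 0 1 UNIV] by (metis empty_iff subset_UNIV zero_less_one)

lemma weight_UNIV_absolutely_integrable:
  assumes "weight UNIV u"
  shows "u absolutely_integrable_on {a..b}"
proof (cases "a < b")
  case True
  then show ?thesis
    by (intro weightD(1)[OF assms] Icc_in_bounded_intervals) simp_all
next
  case False
  then have "{a..b} \<subseteq> {a}" by auto
  then have "negligible {a..b}" by (rule negligible_subset[OF negligible_sing])
  then show ?thesis by (rule absolutely_integrable_negligible)
qed

text \<open>The null set in the \<open>A\<^sub>1\<close> condition depends on the interval.  Intervals with rational
  endpoints give one null set for all of them, and an arbitrary interval is enclosed in slightly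
  larger rational ones, over which the integral of the positive function \<open>u\<close> only grows.\<close>

lemma A_1_bound_UNIV_pointwise:
  assumes u: "weight UNIV u" and A: "A_1_bound UNIV u c"
  obtains N where "negligible N"
    "\<And>\<alpha> \<beta> y. y \<notin> N \<Longrightarrow> \<alpha> < \<beta> \<Longrightarrow> y \<in> {\<alpha>..\<beta>} \<Longrightarrow> integral {\<alpha>..\<beta>} u \<le> c * (\<beta> - \<alpha>) * u y"
proof -
  note int = weight_UNIV_absolutely_integrable[OF u]
  note ne = bounded_intervals_UNIV_nonempty
  have pos: "0 < u x" for x using u unfolding weight_def by blast
  have c: "0 < c"
    and AE: "\<And>I. I \<in> bounded_intervals UNIV \<Longrightarrow> AE x in lebesgue. x \<in> I \<longrightarrow> average I u \<le> c * u x"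
    using A unfolding A_1_bound_iff_AE[OF u ne] by blast+
  let ?P = "\<lambda>p q y. p < q \<longrightarrow> y \<in> {p..q} \<longrightarrow> integral {p..q} u \<le> c * (q - p) * u y"
  have "AE y in lebesgue. ?P p q y" for p q :: real
  proof (cases "p < q")
    case True
    have "average {p..q} u = integral {p..q} u / (q - p)"
      by (rule interval_up_to_endpoints(4)[OF True _ _ int]) auto
    moreover have "AE x in lebesgue. x \<in> {p..q} \<longrightarrow> average {p..q} u \<le> c * u x"
      using True by (intro AE Icc_in_bounded_intervals) simp_all
    ultimately have "AE y in lebesgue. y \<in> {p..q} \<longrightarrow> integral {p..q} u / (q - p) \<le> c * u y"
      by simp
    then show ?thesis
    proof (rule eventually_mono, intro impI)
      fix y assume "y \<in> {p..q} \<longrightarrow> integral {p..q} u / (q - p) \<le> c * u y" "y \<in> {p..q}"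
      then have "integral {p..q} u \<le> c * u y * (q - p)"
        using True by (simp only: pos_divide_le_eq diff_gt_0_iff_gt)
      then show "integral {p..q} u \<le> c * (q - p) * u y" by (simp only: mult_ac)
    qed
  qed simp
  then have "AE y in lebesgue. \<forall>p\<in>\<rat>. \<forall>q\<in>\<rat>. ?P p q y"
    unfolding AE_ball_countable[OF countable_rat] by blast
  then obtain N where N: "\<And>y. y \<in> space lebesgue - N \<Longrightarrow> \<forall>p\<in>\<rat>. \<forall>q\<in>\<rat>. ?P p q y" "N \<in> null_sets lebesgue"
    by (rule AE_E3) blast
  have "integral {\<alpha>..\<beta>} u \<le> c * (\<beta> - \<alpha>) * u y"
    if y: "y \<notin> N" "\<alpha> < \<beta>" "y \<in> {\<alpha>..\<beta>}" for \<alpha> \<beta> y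
  proof (rule field_le_epsilon)
    fix e :: real assume "0 < e"
    \<comment> \<open>Enlarging the interval by at most \<open>d\<close> on both sides costs at most \<open>2 * d * c * u y = e\<close>.\<close>
    define d where "d = e / (2 * c * u y)"
    have "0 < d" using \<open>0 < e\<close> c pos[of y] by (simp add: d_def)
    obtain p where p: "p \<in> \<rat>" "\<alpha> - d < p" "p < \<alpha>"
      using Rats_dense_in_real[of "\<alpha> - d" \<alpha>] \<open>0 < d\<close> by (metis diff_less_eq less_add_same_cancel1)
    obtain q where q: "q \<in> \<rat>" "\<beta> < q" "q < \<beta> + d"
      using Rats_dense_in_real[of \<beta> "\<beta> + d"] \<open>0 < d\<close> by (metis less_add_same_cancel1)
    have "integral {\<alpha>..\<beta>} u \<le> integral {p..q} u"
    proof (rule integral_subset_le)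
      show "{\<alpha>..\<beta>} \<subseteq> {p..q}" using p(3) q(2) by simp
    qed (use int[unfolded absolutely_integrable_on_def] pos in \<open>simp_all add: less_imp_le\<close>)
    also have "\<dots> \<le> c * (q - p) * u y"
      using N(1)[of y] y p(1,3) q(1,2) by simp
    also have "\<dots> \<le> c * (\<beta> - \<alpha> + 2 * d) * u y"
      using p(2) q(3) c pos[of y] by (intro mult_right_mono mult_left_mono) simp_all
    also have "\<dots> = c * (\<beta> - \<alpha>) * u y + d * (2 * c * u y)"
      by (simp only: distrib_left distrib_right mult_ac)
    also have "d * (2 * c * u y) = e"
      using c pos[of y] by (simp add: d_def)
    finally show "integral {\<alpha>..\<beta>} u \<le> c * (\<beta> - \<alpha>) * u y + e" .
  qed
  with N(2) show thesis by (intro that[of N]) (simp_all add: negligible_iff_null_sets)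
qed

lemma A_1_reverse_Holder:
  assumes u: "weight UNIV u" and A: "A_1_bound UNIV u c" and c: "1 \<le> c" and r: "1 < r" and cr: "c * (r - 1) < r"
    and I: "I \<in> bounded_intervals UNIV"
  shows "set_integrable lebesgue I (\<lambda>x. u x powr r)"
    and "average I (\<lambda>x. u x powr r) \<le> r / (r - c * (r - 1)) * average I u powr r"
proof -
  note int = weight_UNIV_absolutely_integrable[OF u]
  have pos: "0 < u x" for x using u unfolding weight_def by blast
  obtain a b where ab: "a < b" "{a<..<b} \<subseteq> I" "I \<subseteq> {a..b}"
    using bounded_intervals_endpoints[OF I] .
  note I_ab = interval_up_to_endpoints[OF ab]
  obtain N where N: "negligible N"
    "\<And>\<alpha> \<beta> y. y \<notin> N \<Longrightarrow> \<alpha> < \<beta> \<Longrightarrow> y \<in> {\<alpha>..\<beta>} \<Longrightarrow> integral {\<alpha>..\<beta>} u \<le> c * (\<beta> - \<alpha>) * u y"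
    by (rule A_1_bound_UNIV_pointwise[OF u A]) (rule that)
  let ?B = "r / (r - c * (r - 1)) * ((integral {a..b} u / (b - a)) powr r * (b - a))"
  have avg_pos: "0 < integral {a..b} u"
    using weightD(2)[OF u I] ab(1) by (simp add: I_ab(4)[OF int] zero_less_divide_iff)
  have le: "(\<integral>\<^sup>+x. ennreal (u x powr r) * indicator {a..b} x \<partial>lebesgue) \<le> ennreal ?B"
    using int[unfolded absolutely_integrable_on_def]
    by (intro reverse_Holder_of_A1_pointwise[where N = N] pos c r cr N ab(1) avg_pos) simp
  have meas: "(\<lambda>x. indicator {a..b} x * u x powr r) \<in> borel_measurable lebesgue"
  proof -
    define f where "f x = indicator {a..b} x * u x" for x
    have [measurable]: "f \<in> borel_measurable lebesgue"
      using int[of a b] unfolding f_def set_integrable_def by (auto dest: borel_measurable_integrable)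
    have "(\<lambda>x. f x powr r) \<in> borel_measurable lebesgue"
      by measurable
    also have "(\<lambda>x. f x powr r) = (\<lambda>x. indicator {a..b} x * u x powr r)"
      by (auto simp: f_def indicator_def)
    finally show ?thesis .
  qed
  have nn: "(\<integral>\<^sup>+x. ennreal (indicator {a..b} x * u x powr r) \<partial>lebesgue) \<le> ennreal ?B"
  proof -
    have "ennreal (indicator {a..b} x * u x powr r) = ennreal (u x powr r) * indicator {a..b} x" for x
      by (simp add: indicator_def)
    then show ?thesis using le by presburger
  qed
  have ai: "(\<lambda>x. u x powr r) absolutely_integrable_on {a..b}"
    unfolding set_integrable_def real_scaleR_def
  proof (rule integrableI_nonneg[OF meas])
    show "AE x in lebesgue. 0 \<le> indicator {a..b} x * u x powr r" by simp
    show "(\<integral>\<^sup>+x. ennreal (indicator {a..b} x * u x powr r) \<partial>lebesgue) < \<infinity>"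
      using le_less_trans[OF nn ennreal_less_top] by simp
  qed
  then show "set_integrable lebesgue I (\<lambda>x. u x powr r)" unfolding I_ab(3) .
  have "integral {a..b} (\<lambda>x. u x powr r) = (LINT x|lebesgue. indicator {a..b} x * u x powr r)"
    using set_lebesgue_integral_eq_integral(2)[OF ai] by (simp add: set_lebesgue_integral_def)
  also have "\<dots> = enn2real (\<integral>\<^sup>+x. ennreal (indicator {a..b} x * u x powr r) \<partial>lebesgue)"
    by (rule integral_eq_nn_integral[OF meas]) simp
  also have "\<dots> \<le> ?B"
    using nn ab(1) r cr by (intro enn2real_leI) simp_all
  finally show "average I (\<lambda>x. u x powr r) \<le> r / (r - c * (r - 1)) * average I u powr r"
    using ab(1) by (simp add: I_ab(4)[OF ai] I_ab(4)[OF int] pos_divide_le_eq mult.assoc)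
qed

text \<open>The tangent at \<open>t = 1\<close> lies below the convex function \<open>t\<^sup>-\<^sup>q\<close>.\<close>

lemma powr_minus_ge_tangent:
  fixes t q :: real
  assumes "0 < t" "0 \<le> q"
  shows "1 - q * (t - 1) \<le> t powr (- q)"
proof -
  have "1 - q * (t - 1) \<le> 1 + (- q) * ln t"
    using mult_left_mono[OF ln_le_minus_one[OF assms(1)] assms(2)] by simp
  also have "\<dots> \<le> exp ((- q) * ln t)" by (rule exp_ge_add_one_self)
  finally show ?thesis using assms(1) by (simp add: powr_def)
qed

text \<open>The upper bound on the left-hand side uses \<open>v \<ge> V / d\<close> and the reverse Hoelder inequality of
  \<open>u\<close>.  The lower bound on the average of \<open>w\<close> uses \<open>u \<ge> U / c\<close> together with Jensen's inequality
  for \<open>v\<^sup>1\<^sup>-\<^sup>p\<close>.  The same power of \<open>V\<close> appears on both sides.\<close>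

lemma factored_weight_RH:
  assumes p: "1 < p" and w: "weight UNIV w" and w_eq: "\<And>x. w x = u x * v x powr (1 - p)"
    and u: "weight UNIV u" "A_1_bound UNIV u c" and c: "1 \<le> c"
    and v: "weight UNIV v" "A_1_bound UNIV v d"
    and r: "1 < r" and cr: "c * (r - 1) < r"
  shows "w \<in> RH r UNIV"
proof -
  define K where "K = r / (r - c * (r - 1))"
  have K: "0 < K" using r cr by (simp add: K_def)
  note ne = bounded_intervals_UNIV_nonempty
  have pos: "0 < u x" "0 < v x" "0 < w x" for x
    using u(1) v(1) w unfolding weight_def by blast+
  have d: "0 < d" using v(2) unfolding A_1_bound_iff_AE[OF v(1) ne] by blast
  define C where "C = (1 / d) powr (1 - p) * K powr (1 / r) * c"
  have main: "set_integrable lebesgue I (\<lambda>x. w x powr r) \<and>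
      average I (\<lambda>x. w x powr r) powr (1 / r) \<le> C * average I w"
    if I: "I \<in> bounded_intervals UNIV" for I
  proof -
    define U V where "U = average I u" and "V = average I v"
    have UV: "0 < U" "0 < V"
      using weightD(2)[OF u(1) I] weightD(2)[OF v(1) I] by (simp_all add: U_def V_def)
    have u_ge: "AE x in lebesgue. x \<in> I \<longrightarrow> U \<le> c * u x"
      using u(2) I unfolding A_1_bound_iff_AE[OF u(1) ne] U_def by blast
    have v_ge: "AE x in lebesgue. x \<in> I \<longrightarrow> V \<le> d * v x"
      using v(2) I unfolding A_1_bound_iff_AE[OF v(1) ne] V_def by blast
    note RHu = A_1_reverse_Holder[OF u c r cr I, folded K_def U_def]
    define B where "B = ((V / d) powr (1 - p)) powr r"
    have w_le: "AE x in lebesgue. x \<in> I \<longrightarrow> w x powr r \<le> B * u x powr r"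
      using v_ge
    proof (rule eventually_mono, intro impI)
      fix x assume "x \<in> I \<longrightarrow> V \<le> d * v x" "x \<in> I"
      then have "V / d \<le> v x" using d by (simp add: pos_divide_le_eq mult.commute)
      then have "v x powr (1 - p) \<le> (V / d) powr (1 - p)"
        using p UV d by (intro powr_mono2') simp_all
      then have "w x \<le> (V / d) powr (1 - p) * u x"
        unfolding w_eq using pos(1)[of x] by (simp add: mult.commute)
      then have "w x powr r \<le> ((V / d) powr (1 - p) * u x) powr r"
        using r pos(3)[of x] by (intro powr_mono2) simp_all
      then show "w x powr r \<le> B * u x powr r"
        using pos(1)[of x] by (simp add: powr_mult B_def)
    qed
    have int_Bu: "set_integrable lebesgue I (\<lambda>x. B * u x powr r)"
      by (rule set_integrable_mult_right) (rule RHu(1))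
    have meas: "set_borel_measurable lebesgue I (\<lambda>x. w x powr r)"
    proof -
      define f where "f x = indicator I x * w x" for x
      have [measurable]: "f \<in> borel_measurable lebesgue"
        using weightD(1)[OF w I] unfolding f_def set_integrable_def by (auto dest: borel_measurable_integrable)
      have "(\<lambda>x. f x powr r) \<in> borel_measurable lebesgue"
        by measurable
      also have "(\<lambda>x. f x powr r) = (\<lambda>x. indicator I x *\<^sub>R w x powr r)"
        by (auto simp: f_def indicator_def)
      finally show ?thesis unfolding set_borel_measurable_def .
    qed
    have int_w: "set_integrable lebesgue I (\<lambda>x. w x powr r)"
    proof (rule set_integrable_bound[OF int_Bu meas])
      show "AE x in lebesgue. x \<in> I \<longrightarrow> norm (w x powr r) \<le> norm (B * u x powr r)"
        using w_le by (rule eventually_mono) (simp add: B_def)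
    qed
    have "average I (\<lambda>x. w x powr r) \<le> average I (\<lambda>x. B * u x powr r)"
      by (rule average_mono_AE[OF int_w int_Bu w_le])
    also have "\<dots> \<le> B * (K * U powr r)"
      unfolding average_cmult using RHu(2) by (rule mult_left_mono) (simp add: B_def)
    finally have "average I (\<lambda>x. w x powr r) powr (1 / r) \<le> (B * (K * U powr r)) powr (1 / r)"
      using r by (intro powr_mono2)
        (simp_all add: average_def set_lebesgue_integral_def integral_nonneg_AE)
    also have "\<dots> = (V / d) powr (1 - p) * K powr (1 / r) * U"
      using r K UV by (simp add: powr_mult powr_powr B_def)
    also have "(V / d) powr (1 - p) = (1 / d) powr (1 - p) * V powr (1 - p)"
      using d UV by (simp add: powr_mult[symmetric])
    finally have upper: "average I (\<lambda>x. w x powr r) powr (1 / r)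
        \<le> (1 / d) powr (1 - p) * V powr (1 - p) * K powr (1 / r) * U" .

    \<comment> \<open>Jensen's inequality through the tangent of \<open>t\<^sup>1\<^sup>-\<^sup>p\<close> at \<open>t = V\<close>: an affine function of \<open>v\<close> is a
      minorant of \<open>w\<close> whose average is explicit.\<close>
    define l where "l x = U / c * V powr (1 - p) * (p - (p - 1) / V * v x)" for x
    have int_l: "set_integrable lebesgue I l"
      unfolding l_def
      by (intro set_integrable_mult_right set_integral_diff(1) set_integrable_const_interval[OF I] weightD(1)[OF v(1) I])
    have "average I l = U / c * V powr (1 - p) * average I (\<lambda>x. p - (p - 1) / V * v x)"
      unfolding l_def by (rule average_cmult)
    also have "average I (\<lambda>x. p - (p - 1) / V * v x) = p - (p - 1) / V * V"
    proof -
      have "average I (\<lambda>x. p - (p - 1) / V * v x) = average I (\<lambda>x. p) - average I (\<lambda>x. (p - 1) / V * v x)"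
        unfolding average_def diff_divide_distrib[symmetric]
        by (subst set_integral_diff(2))
           (intro set_integrable_mult_right set_integrable_const_interval[OF I] weightD(1)[OF v(1) I] refl)+
      then show ?thesis by (simp only: average_cmult average_const[OF I] V_def)
    qed
    also have "p - (p - 1) / V * V = 1" using UV by simp
    finally have "average I l = U / c * V powr (1 - p)" by simp
    moreover have "average I l \<le> average I w"
    proof (rule average_mono_AE[OF int_l weightD(1)[OF w I]])
      show "AE x in lebesgue. x \<in> I \<longrightarrow> l x \<le> w x"
        using u_ge
      proof (rule eventually_mono, intro impI)
        fix x assume "x \<in> I \<longrightarrow> U \<le> c * u x" "x \<in> I"
        then have U: "U / c \<le> u x" using c by (simp add: pos_divide_le_eq mult.commute)
        have "p - (p - 1) / V * v x = 1 - (p - 1) * (v x / V - 1)"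
          by (simp add: right_diff_distrib)
        also have "\<dots> \<le> (v x / V) powr (- (p - 1))"
          using p UV pos(2)[of x] by (intro powr_minus_ge_tangent) simp_all
        finally have "V powr (1 - p) * (p - (p - 1) / V * v x) \<le> V powr (1 - p) * (v x / V) powr (1 - p)"
          by (intro mult_left_mono) simp_all
        also have "\<dots> = v x powr (1 - p)"
          using UV pos(2)[of x] by (simp add: powr_mult[symmetric])
        finally have "U / c * (V powr (1 - p) * (p - (p - 1) / V * v x)) \<le> U / c * v x powr (1 - p)"
          using UV c by (intro mult_left_mono) simp_all
        also have "\<dots> \<le> u x * v x powr (1 - p)"
          using U by (intro mult_right_mono) simp_all
        finally show "l x \<le> w x" by (simp add: l_def w_eq mult.assoc)
      qed
    qed
    ultimately have "U * V powr (1 - p) \<le> c * average I w"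
      using c by (simp add: pos_divide_le_eq mult.commute)
    then have "((1 / d) powr (1 - p) * K powr (1 / r)) * (U * V powr (1 - p))
        \<le> ((1 / d) powr (1 - p) * K powr (1 / r)) * (c * average I w)"
      by (intro mult_left_mono) simp_all
    with upper have "average I (\<lambda>x. w x powr r) powr (1 / r) \<le> C * average I w"
      by (simp add: C_def mult_ac)
    with int_w show ?thesis by blast
  qed
  then show ?thesis using w unfolding RH_def by blast
qed

section \<open>Power weights on the half-line\<close>

lemma powr_absolutely_integrable:
  fixes s a b :: real
  assumes s: "0 < s" and ab: "0 \<le> a" "a < b"
  shows "(\<lambda>x. x powr (s - 1)) absolutely_integrable_on {a..b}"
    and "integral {a..b} (\<lambda>x. x powr (s - 1)) = (b powr s - a powr s) / s"
proof -
  have "((\<lambda>x. x powr (s - 1)) has_integral (b powr s / s - a powr s / s)) {a..b}"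
  proof (rule fundamental_theorem_of_calculus_interior)
    show "continuous_on {a..b} (\<lambda>x. x powr s / s)"
      using s ab by (intro continuous_intros continuous_on_powr') auto
    fix x assume "x \<in> {a<..<b}"
    then show "((\<lambda>x. x powr s / s) has_vector_derivative x powr (s - 1)) (at x)"
      using s ab unfolding has_real_derivative_iff_has_vector_derivative[symmetric]
      by (auto intro!: derivative_eq_intros)
  qed (use ab in simp)
  then have *: "((\<lambda>x. x powr (s - 1)) has_integral ((b powr s - a powr s) / s)) {a..b}"
    by (simp add: diff_divide_distrib)
  then show "integral {a..b} (\<lambda>x. x powr (s - 1)) = (b powr s - a powr s) / s"
    by (rule integral_unique)
  show "(\<lambda>x. x powr (s - 1)) absolutely_integrable_on {a..b}"
    using * by (intro nonnegative_absolutely_integrable_1) (auto simp: integrable_on_def)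
qed

lemma bounded_intervals_pos_endpoints:
  assumes "I \<in> bounded_intervals {0<..}"
  obtains a b where "0 \<le> a" "a < b" "{a<..<b} \<subseteq> I" "I \<subseteq> {a..b}"
proof -
  obtain a b where ab: "a < b" "{a<..<b} \<subseteq> I" "I \<subseteq> {a..b}"
    using bounded_intervals_endpoints[OF assms] .
  have "0 \<le> a"
  proof (rule ccontr)
    assume "\<not> 0 \<le> a"
    then obtain x where "a < x" "x < min 0 b" using dense[of a "min 0 b"] ab(1) by auto
    then have "x \<in> I" "x < 0" using ab(2) by auto
    then show False using bounded_intervalsD(1)[OF assms] by auto
  qed
  with ab that show thesis by blast
qed

lemma weight_powr: "0 < s \<Longrightarrow> weight {0<..} (\<lambda>x. x powr (s - 1))"
  unfolding weight_def
proof (intro conjI ballI)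
  fix I :: "real set" assume "0 < s" and I: "I \<in> bounded_intervals {0<..}"
  obtain a b where ab: "0 \<le> a" "a < b" "{a<..<b} \<subseteq> I" "I \<subseteq> {a..b}"
    using I by (rule bounded_intervals_pos_endpoints)
  show "set_integrable lebesgue I (\<lambda>x. x powr (s - 1))"
    unfolding interval_up_to_endpoints(3)[OF ab(2-4)]
    using \<open>0 < s\<close> ab by (intro powr_absolutely_integrable(1))
qed simp

lemma unit_interval: "{0<..<1} \<in> bounded_intervals {0 :: real<..}"
  by (auto simp: bounded_intervals_def is_interval_oo)

text \<open>The average over \<open>(a, b)\<close> is largest, relative to the value at \<open>b\<close>, for \<open>a = 0\<close>, where equality
  holds.\<close>

lemma average_powr_le:
  assumes s: "0 < s" "s \<le> 1" and ab: "0 \<le> a" "a < b" "{a<..<b} \<subseteq> I" "I \<subseteq> {a..b}"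
  shows "average I (\<lambda>x. x powr (s - 1)) \<le> b powr (s - 1) / s"
proof -
  have "a * b powr (s - 1) \<le> a powr s"
  proof (cases "a = 0")
    case False
    then have "b powr (s - 1) \<le> a powr (s - 1)"
      using s ab by (intro powr_mono2') auto
    then have "a * b powr (s - 1) \<le> a * a powr (s - 1)"
      using ab(1) by (rule mult_left_mono)
    also have "\<dots> = a powr s" using powr_mult_base[of a "s - 1"] ab(1) by simp
    finally show ?thesis .
  qed simp
  moreover have "b powr s = b * b powr (s - 1)"
    using powr_mult_base[of b "s - 1"] ab by simp
  ultimately have "b powr s - a powr s \<le> b powr (s - 1) * (b - a)"
    by (simp add: algebra_simps)
  then have "(b powr s - a powr s) / s / (b - a) \<le> b powr (s - 1) / s"
    using s ab(2) by (simp add: pos_divide_le_eq divide_right_mono mult.commute)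
  then show ?thesis
    using interval_up_to_endpoints(4)[OF ab(2-4) powr_absolutely_integrable(1)[OF s(1) ab(1,2)]]
      powr_absolutely_integrable(2)[OF s(1) ab(1,2)] by simp
qed

text \<open>The intervals \<open>(0, b)\<close> are extremal.  On \<open>(0, 1)\<close> the average is \<open>1 / s\<close> and the essential
  infimum is the limit of \<open>x\<^sup>s\<^sup>-\<^sup>1\<close> at \<open>1\<close>, which rules out any smaller constant.\<close>

lemma powr_A_1:
  assumes s: "0 < s" "s < 1"
  shows "A_1_bound {0<..} (\<lambda>x. x powr (s - 1)) (1 / s)"
    and "A_1_const {0<..} (\<lambda>x. x powr (s - 1)) = 1 / s"
proof -
  let ?u = "\<lambda>x :: real. x powr (s - 1)"
  have ne: "bounded_intervals {0 :: real<..} \<noteq> {}" using unit_interval by blast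
  note iff = A_1_bound_iff_AE[OF weight_powr[OF s(1)] ne]
  show bound: "A_1_bound {0<..} ?u (1 / s)"
    unfolding iff
  proof (intro conjI ballI)
    show "0 < 1 / s" using s by simp
    fix I :: "real set" assume "I \<in> bounded_intervals {0<..}"
    then obtain a b where ab: "0 \<le> a" "a < b" "{a<..<b} \<subseteq> I" "I \<subseteq> {a..b}"
      by (rule bounded_intervals_pos_endpoints)
    have "average I ?u \<le> 1 / s * ?u x" if "x \<in> I" "0 < x" for x
    proof -
      have "average I ?u \<le> b powr (s - 1) / s"
        using s ab by (intro average_powr_le) auto
      also have "\<dots> \<le> x powr (s - 1) / s"
        using s ab that by (intro divide_right_mono powr_mono2') auto
      finally show ?thesis by simp
    qed
    moreover have "0 < x" if "x \<in> I" for x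
      using bounded_intervalsD(1)[OF \<open>I \<in> bounded_intervals {0<..}\<close>] that by auto
    ultimately show "AE x in lebesgue. x \<in> I \<longrightarrow> average I ?u \<le> 1 / s * ?u x"
      by (intro AE_I2) blast
  qed
  have lower: "1 / s \<le> c" if "A_1_bound {0<..} ?u c" for c
  proof -
    have c: "0 < c" and AE: "AE x in lebesgue. x \<in> {0<..<1} \<longrightarrow> average {0<..<1} ?u \<le> c * ?u x"
      using that unit_interval unfolding iff by blast+
    have avg: "average {0<..<1} ?u = 1 / s"
      using interval_up_to_endpoints(4)[of 0 1 "{0<..<1}", OF _ _ _ powr_absolutely_integrable(1)[OF s(1), of 0 1]]
        powr_absolutely_integrable(2)[OF s(1), of 0 1] s(1)
      by (simp add: greaterThanLessThan_subseteq_atLeastAtMost_iff)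
    have "1 / s \<le> c * ?u t" if t: "t \<in> {0<..<1}" for t
    proof -
      have "\<exists>x. x \<in> {t<..<1} \<and> average {0<..<1} ?u \<le> c * ?u x"
      proof (rule ccontr)
        assume no: "\<not> ?thesis"
        have "AE x in lebesgue. x \<notin> {t<..<1}"
          using AE by (rule eventually_mono) (use no t in auto)
        then have "{t<..<1} \<in> null_sets lebesgue"
          by (subst AE_iff_null_sets) simp_all
        then show False using t by (simp add: null_sets_def)
      qed
      then obtain x where x: "x \<in> {t<..<1}" "average {0<..<1} ?u \<le> c * ?u x" by blast
      then have "1 / s \<le> c * ?u x" using t avg by simp
      also have "\<dots> \<le> c * ?u t"
        using x(1) t s c by (intro mult_left_mono powr_mono2') auto
      finally show ?thesis .
    qed
    moreover have "((\<lambda>t. c * ?u t) \<longlongrightarrow> c * ?u 1) (at_left 1)"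
      by (intro tendsto_intros) auto
    moreover have "eventually (\<lambda>t. t \<in> {0<..<1}) (at_left (1 :: real))"
      by (rule eventually_at_left_real) simp
    ultimately have "1 / s \<le> c * ?u 1"
      using tendsto_lowerbound[OF _ eventually_mono trivial_limit_at_left_real] by blast
    then show ?thesis by simp
  qed
  show "A_1_const {0<..} ?u = 1 / s"
    unfolding A_1_const_def using bound lower by (intro cInf_eq_minimum) auto
qed

text \<open>The dual weight is an increasing power \<open>x\<^sup>q\<close>, bounded on the interval by \<open>b\<^sup>q\<close> with
  \<open>q (p - 1) = 1 - s\<close>; this compensates exactly for the factor \<open>b\<^sup>s\<^sup>-\<^sup>1\<close> in the average of the weight.\<close>

lemma powr_A_p:
  assumes s: "0 < s" "s < 1" and p: "1 < p"
  shows "(\<lambda>x. x powr (s - 1)) \<in> A_p p {0<..}"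
proof -
  define q where "q = (1 - s) / (p - 1)"
  have q: "0 < q" using s p by (simp add: q_def)
  have "(s - 1) * (1 - p / (p - 1)) = (1 - s) * (p / (p - 1) - 1)"
    by (metis minus_diff_eq minus_mult_minus)
  also have "p / (p - 1) - 1 = (p - 1 * (p - 1)) / (p - 1)"
    by (rule divide_diff_eq_iff) (use p in simp)
  also have "(1 - s) * \<dots> = q"
    by (simp add: q_def)
  finally have dual: "(x powr (s - 1)) powr (1 - p / (p - 1)) = x powr q" for x :: real
    by (simp add: powr_powr)
  have "set_integrable lebesgue I (\<lambda>x. x powr q) \<and>
    average I (\<lambda>x. x powr (s - 1)) * average I (\<lambda>x. x powr q) powr (p - 1) \<le> 1 / s"
    if I: "I \<in> bounded_intervals {0<..}" for I
  proof -
    obtain a b where ab: "0 \<le> a" "a < b" "{a<..<b} \<subseteq> I" "I \<subseteq> {a..b}"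
      using I by (rule bounded_intervals_pos_endpoints)
    have int: "set_integrable lebesgue I (\<lambda>x. x powr q)"
      using powr_absolutely_integrable(1)[of "q + 1" a b] q ab
      by (simp add: interval_up_to_endpoints(3)[OF ab(2-4)])
    have "average I (\<lambda>x. x powr q) \<le> average I (\<lambda>x. b powr q)"
    proof (rule average_mono_AE[OF int set_integrable_const_interval[OF I]])
      show "AE x in lebesgue. x \<in> I \<longrightarrow> x powr q \<le> b powr q"
        using ab q by (intro AE_I2 impI powr_mono2) auto
    qed
    also have "\<dots> = b powr q" by (rule average_const[OF I])
    finally have "average I (\<lambda>x. x powr q) powr (p - 1) \<le> (b powr q) powr (p - 1)"
      using p by (intro powr_mono2) (simp_all add: average_def set_lebesgue_integral_def integral_nonneg_AE)
    also have "\<dots> = b powr (1 - s)"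
      using p by (simp add: powr_powr q_def)
    finally have "average I (\<lambda>x. x powr (s - 1)) * average I (\<lambda>x. x powr q) powr (p - 1)
        \<le> b powr (s - 1) / s * b powr (1 - s)"
    proof (rule mult_mono[rotated])
      show "average I (\<lambda>x. x powr (s - 1)) \<le> b powr (s - 1) / s"
        by (rule average_powr_le[OF _ _ ab]) (use s in simp_all)
    qed (use s in simp_all)
    also have "\<dots> = 1 / s"
      using ab by (simp add: powr_add[symmetric])
    finally show ?thesis using int by blast
  qed
  then show ?thesis
    unfolding A_p_def dual mem_Collect_eq
    by (intro conjI exI[of _ "1 / s"] weight_powr[OF s(1)]) (rule ballI)
qed

text \<open>Near \<open>0\<close> the function dominates \<open>1 / x\<close>, whose integral over \<open>[t, 1]\<close> is \<open>- ln t\<close>.\<close>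

lemma powr_not_integrable_at_0:
  fixes e :: real
  assumes "e \<le> - 1"
  shows "\<not> (\<lambda>x. x powr e) integrable_on {0..1}"
proof
  assume int: "(\<lambda>x. x powr e) integrable_on {0..1}"
  define J where "J = integral {0..1} (\<lambda>x. x powr e)"
  have "- ln t \<le> J" if t: "t \<in> {0<..<1}" for t
  proof -
    have int_t: "(\<lambda>x. x powr e) integrable_on {t..1}"
      by (rule integrable_on_subinterval[OF int]) (use t in simp)
    have ln: "((\<lambda>x. inverse x) has_integral (ln 1 - ln t)) {t..1}"
      using t by (intro fundamental_theorem_of_calculus)
        (auto intro!: derivative_eq_intros simp: inverse_eq_divide
          simp flip: has_real_derivative_iff_has_vector_derivative)
    then have "- ln t = integral {t..1} inverse"
      by (simp add: integral_unique)
    also have "\<dots> \<le> integral {t..1} (\<lambda>x. x powr e)"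
    proof (rule integral_le[OF _ int_t])
      show "inverse x \<le> x powr e" if "x \<in> {t..1}" for x
      proof -
        have x: "0 < x" "x \<le> 1" using that t by simp_all
        have "inverse x = x powr (- 1)" using x(1) by (simp add: powr_minus)
        also have "\<dots> \<le> x powr e" by (rule powr_mono'[OF assms]) (use x in simp_all)
        finally show ?thesis .
      qed
      show "inverse integrable_on {t..1}" using ln unfolding integrable_on_def by blast
    qed
    also have "\<dots> \<le> J"
      unfolding J_def using t int_t by (intro integral_subset_le int) simp_all
    finally show ?thesis .
  qed
  moreover have "exp (- (\<bar>J\<bar> + 1)) \<in> {0<..<1}"
  proof -
    have "- (\<bar>J\<bar> + 1) < 0" by linarith
    then show ?thesis by (simp only: greaterThanLessThan_iff exp_gt_zero exp_less_one_iff simp_thms)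
  qed
  ultimately have "- ln (exp (- (\<bar>J\<bar> + 1))) \<le> J" by blast
  then show False by (simp only: ln_exp)
qed

lemma powr_not_RH:
  assumes s: "0 < s" "s < 1" and r: "1 \<le> (1 - s) * r"
  shows "(\<lambda>x. x powr (s - 1)) \<notin> RH r {0<..}"
proof
  assume "(\<lambda>x. x powr (s - 1)) \<in> RH r {0<..}"
  then have "set_integrable lebesgue {0<..<1} (\<lambda>x. (x powr (s - 1)) powr r)"
    using unit_interval unfolding RH_def by blast
  then have "(\<lambda>x. x powr ((s - 1) * r)) absolutely_integrable_on {0..1}"
    using interval_up_to_endpoints(3)[of 0 1 "{0<..<1}"]
    by (simp add: powr_powr greaterThanLessThan_subseteq_atLeastAtMost_iff)
  then have "(\<lambda>x. x powr ((s - 1) * r)) integrable_on {0..1}"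
    by (simp add: absolutely_integrable_on_def)
  then show False using powr_not_integrable_at_0[of "(s - 1) * r"] r by (simp add: algebra_simps)
qed

section \<open>The optimal range of exponents\<close>

theorem theorem5:
  shows "(\<forall>(p::real) (u::real \<Rightarrow> real) (v::real \<Rightarrow> real) (w::real \<Rightarrow> real) (c::real).
            1 < p \<and> weight UNIV w \<and> (\<forall>x. w x = u x * v x powr (1 - p)) \<and>
            w \<in> A_p p UNIV \<and> u \<in> A_1 UNIV \<and> v \<in> A_1 UNIV \<and> c = A_1_const UNIV u \<longrightarrow>
            (\<forall>r::real. 1 < r \<and> ereal r < (if c = 1 then \<infinity> else ereal (c / (c - 1))) \<longrightarrow>
               w \<in> RH r UNIV))
       \<and> (\<forall>(p::real) (c::real). 1 < p \<and> 1 < c \<longrightarrow>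
            (\<exists>(u::real \<Rightarrow> real) (v::real \<Rightarrow> real) (w::real \<Rightarrow> real).
               u \<in> A_1 {0<..} \<and> v \<in> A_1 {0<..} \<and> A_1_const {0<..} u = c \<and>
               (\<forall>x\<in>{0<..}. w x = u x * v x powr (1 - p)) \<and> w \<in> A_p p {0<..} \<and>
               (\<forall>r::real. c / (c - 1) \<le> r \<longrightarrow> w \<notin> RH r {0<..})))"
proof (intro conjI allI impI, goal_cases)
  case (1 p u v w c r)
  then have r: "1 < r" and p: "1 < p" and w: "weight UNIV w" "\<And>x. w x = u x * v x powr (1 - p)"
    and u: "weight UNIV u" and v: "weight UNIV v" and c: "c = Inf {c. A_1_bound UNIV u c}"
    and ne: "{c. A_1_bound UNIV u c} \<noteq> {}"
    by (auto simp: A_1_def A_1_const_def)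
  obtain d where d: "A_1_bound UNIV v d" using 1 by (auto simp: A_1_def)
  \<comment> \<open>The map \<open>x \<mapsto> x / (x - 1)\<close> is a decreasing involution of \<open>(1, \<infinity>)\<close>, which turns the
    condition on \<open>r\<close> into an upper bound on \<open>c\<close>; for \<open>c < 1\<close> there is no admissible \<open>r\<close>.\<close>
  have "c < r / (r - 1)"
  proof (cases "c = 1")
    case True
    then show ?thesis using r by (simp add: pos_less_divide_eq)
  next
    case False
    then have rc: "r < c / (c - 1)" using 1 by simp
    have "1 < c"
    proof (rule ccontr)
      assume "\<not> 1 < c"
      with False have "c - 1 < 0" by simp
      then have "c / (c - 1) < 1" by (simp add: neg_divide_less_eq)
      with rc r show False by simp
    qed
    then have "r * (c - 1) < c" using rc by (simp add: pos_less_divide_eq)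
    then have "c * (r - 1) < r" by (simp add: right_diff_distrib mult.commute)
    then show ?thesis using r by (simp add: pos_less_divide_eq)
  qed
  \<comment> \<open>The bound is strict, so it survives passing from the infimum to an actual \<open>A\<^sub>1\<close> bound.\<close>
  then obtain c' where c': "A_1_bound UNIV u c'" "c' < r / (r - 1)"
    using cInf_lessD[OF ne] c by auto
  have "A_1_bound UNIV u (max c' 1)"
    by (rule A_1_bound_mono[OF u bounded_intervals_UNIV_nonempty c'(1)]) simp
  moreover have "max c' 1 * (r - 1) < r"
    using c'(2) r by (simp add: max_def pos_less_divide_eq)
  ultimately show ?case
    using factored_weight_RH[OF p w u _ _ v d r] by simp
next
  case (2 p c)
  define s where "s = 1 / c"
  have s: "0 < s" "s < 1" "1 / s = c" using 2 by (simp_all add: s_def)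
  let ?u = "\<lambda>x :: real. x powr (s - 1)" and ?v = "\<lambda>x :: real. 1 :: real"
  have ne: "bounded_intervals {0 :: real<..} \<noteq> {}" using unit_interval by blast
  have v: "weight {0<..} ?v"
    by (simp add: weight_def set_integrable_const_interval)
  have "?v \<in> A_1 {0<..}"
    unfolding A_1_def using v A_1_bound_iff_AE[OF v ne, of 1] by (auto simp: average_const)
  moreover have "?u \<in> A_1 {0<..}" "A_1_const {0<..} ?u = c"
    using powr_A_1[OF s(1,2)] weight_powr[OF s(1)] s(3) by (auto simp: A_1_def)
  moreover have "?u \<notin> RH r {0<..}" if "c / (c - 1) \<le> r" for r
  proof (rule powr_not_RH[OF s(1,2)])
    have "c \<le> r * (c - 1)" using that 2 by (simp add: pos_divide_le_eq)
    then have "1 \<le> (c - 1) / c * r" using 2 by (simp add: pos_le_divide_eq mult.commute)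
    also have "(c - 1) / c = 1 - s" using 2 by (simp add: s_def diff_divide_distrib)
    finally show "1 \<le> (1 - s) * r" .
  qed
  moreover have "?u \<in> A_p p {0<..}" using powr_A_p[OF s(1,2)] 2 by simp
  ultimately have *: "?u \<in> A_1 {0<..} \<and> ?v \<in> A_1 {0<..} \<and> A_1_const {0<..} ?u = c \<and>
      (\<forall>x\<in>{0<..}. ?u x = ?u x * ?v x powr (1 - p)) \<and> ?u \<in> A_p p {0<..} \<and>
      (\<forall>r. c / (c - 1) \<le> r \<longrightarrow> ?u \<notin> RH r {0<..})"
    by simp
  show ?case
    by (rule exI[of _ ?u], rule exI[of _ ?v], rule exI[of _ ?u], rule *)
qed

end
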